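(* Let $\{X_M\}$ be a good covering of the sphere $S^2$ with constant $\alpha>0$, let $\theta\in(0,1)$ be fixed, and let $\mathcal{A}_n=X_{M_n}$ be the corresponding good covering optimal polynomial mesh of $S^2$ (with constant $C=1/(1-\theta)$), where $$M_n=\lceil\sigma_n^2n^2\rceil,\qquad\sigma_n=\frac{2\pi\alpha}{\theta(2\pi-\theta/n)}\sim\frac{\alpha}{\theta},\quad n\to\infty.$$ Let $T_{2n}$ be the Caratheodory-Tchakaloff submesh extracted from $\mathcal{A}_n$ (with corresponding weights). Then $T_{2n}$ is a weakly admissible mesh for the sphere with cardinality $N_{2n}=\dim(\mathbb{P}^3_{2n}(S^2))=(2n+1)^2$, and the estimate $$\|f-\mathcal{L}^w_{T_{2n}}f\|_{L^\infty(S^2)}\leq(1+C_n)\min_{p\in\mathbb{P}_n^3(S^2)}\|f-p\|_{L^\infty(S^2)}$$ holds for the corresponding weighted least squares polynomial approximation $\mathcal{L}^w_{T_{2n}}f$ to $f\in C(S^2)$, where $$C_n=\frac{\sigma_n\,n}{1-\theta}\sim\frac{\alpha n}{\theta(1-\theta)},\qquad n\to\infty.$$ In particular, for a Caratheodory-Tchakaloff submesh of the zonal equal area configurations with $M_n=\left\lceil 49\left(n-\frac{1}{4\pi}\right)^2\right\rceil$ points (which are taken as an optimal polynomial mesh of the sphere with $C=2$, corresponding to $\alpha=3.5$, $\theta=1/2$), one has $$C_n=\frac{14n}{1-(4\pi n)^{-1}}\sim 14n,\qquad n\to\infty.$$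
   Context: $S^2$ is the unit sphere of $\mathbb{R}^3$. A sequence of finite point configurations $X_M\subset S^2$, with cardinality $M\geq 2$, is a good covering of the sphere with constant $\alpha>0$ if its covering radius $\eta(X_M)=\max_{x\in S^2}\min_{y\in X_M}|x-y|$ (Euclidean norm) satisfies $\eta(X_M)\leq\alpha/\sqrt{M}$. $\mathbb{P}_n^3(S^2)$ is the space of restrictions to $S^2$ of real trivariate polynomials of total degree at most $n$; its dimension is $N_n=(n+1)^2$. An optimal polynomial mesh of $S^2$ with constant $C$ is a sequence of finite subsets $\mathcal{A}_n\subset S^2$ with $\mathrm{card}(\mathcal{A}_n)=\mathcal{O}(N_n)$ and $\|p\|_{L^\infty(S^2)}\leq C\,\|p\|_{\ell^\infty(\mathcal{A}_n)}$ for all $p\in\mathbb{P}_n^3(S^2)$. A weakly admissible polynomial mesh for $S^2$ with constants $C_n$ is a sequence of finite subsets of $S^2$, of cardinality $\mathcal{O}(N_n^\beta)$ for some $\beta\geq 1$, such that the sup norm on $S^2$ of every $p\in\mathbb{P}_n^3(S^2)$ is at most $C_n$ times its maximum modulus on the $n$-th subset, where $C_n$ increases subexponentially (in particular $C_n=\mathcal{O}(n^s)$, $s\geq 0$). Here the $n$-th subset is the one denoted $T_{2n}$ (the subscript refers to the exactness degree $2n$), and the same $C_n$ is the mesh constant and the constant in the error estimate. A Caratheodory-Tchakaloff submesh $T_{2n}$ of $\mathcal{A}_n$ is a set of nodes $\{t_j\}_{1\leq j\leq m}\subseteq\mathcal{A}_n$, $m\leq N_{2n}$, with positive weights $\boldsymbol{w}=\{w_j\}$,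 such that $\sum_{x\in\mathcal{A}_n}p(x)=\sum_{j=1}^m w_j\,p(t_j)$ for all polynomials $p$ of total degree at most $2n$ (such nodes and weights exist by the discrete version of Tchakaloff's theorem). The polynomial $\mathcal{L}^w_{T_{2n}}f\in\mathbb{P}^3_n(S^2)$ is the minimizer of $\sum_{j=1}^m w_j\,(f(t_j)-p(t_j))^2$ over $p\in\mathbb{P}_n^3(S^2)$. Zonal equal area configurations (standard definition). For $M\geq 2$, the recursive zonal equal area partition of $S^2$ into $M$ regions of area $V=4\pi/M$ is built as follows. Take two polar caps of spherical radius $\vartheta_c=2\arcsin(1/\sqrt{M})$ (each of area $V$). If $M=2$ there are no collars; otherwise let the number of collars be $k=\max\{1,\mathrm{round}((\pi-2\vartheta_c)/\sqrt{V})\}$, let $\delta=(\pi-2\vartheta_c)/k$, and let $y_i$ be the area of the zone with colatitude in $[\vartheta_c+(i-1)\delta,\vartheta_c+i\delta]$ divided by $V$, $1\leq i\leq k$. Set $a_0=0$, $m_i=\mathrm{round}(y_i+a_{i-1})$, $a_i=\sum_{j\leq i}(y_j-m_j)$. Let $\vartheta_0=\vartheta_c$ and let $\vartheta_i$ be the colatitude for which the cap of spherical radius $\vartheta_i$ centred at the north pole has area $(1+m_1+\dots+m_i)V$. The $i$-th collar, with colatitude in $[\vartheta_{i-1},\vartheta_i]$, is divided into $m_i$ sectors of equal longitude width (with some longitude offset). The zonal equal area configuration $X_M$ consists of the two poles and, for each collar sector, the point whose colatitude and longitude are the midpoints of the colatitude and longitude intervals of the sector; thus $\mathrm{card}(X_M)=M$.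 It is known from the literature, and taken for granted, that these configurations are a good covering with $\alpha=3.5$, i.e. $\eta(X_M)\leq 3.5/\sqrt{M}$.
   Formalization: The cardinality of T_{2n} is stated as at most N_{2n}=(2n+1)^2 rather than equal to it: if A_1 is a disjoint union of regular tetrahedra, a single tetrahedron with equal weights is a Caratheodory-Tchakaloff submesh with 4 < 9 nodes. *)

theory Defs
  imports
    "HOL-Analysis.Analysis"
    "HOL-Library.Function_Algebras"
    "HOL-Library.Landau_Symbols"
begin

abbreviation S2 :: "(real^3) set" where
  "S2 \<equiv> sphere 0 1"


section \<open>Polynomials on the sphere\<close>

definition poly3 :: "nat \<Rightarrow> (real^3 \<Rightarrow> real) set" where
  "poly3 n = {p. \<exists>c :: nat \<Rightarrow> nat \<Rightarrow> nat \<Rightarrow> real.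
     p = (\<lambda>x. \<Sum>(i,j,k)\<in>{(i,j,k). i + j + k \<le> n}. c i j k * x$1 ^ i * x$2 ^ j * x$3 ^ k)}"

text \<open>Functions on the sphere are represented by their extension by zero, so that two
  restrictions are equal as HOL functions iff they agree on the sphere.\<close>

definition sph_poly :: "nat \<Rightarrow> (real^3 \<Rightarrow> real) set" where
  "sph_poly n = (\<lambda>p x. if x \<in> S2 then p x else 0) ` poly3 n"

definition fun_scale :: "real \<Rightarrow> (real^3 \<Rightarrow> real) \<Rightarrow> real^3 \<Rightarrow> real" where
  "fun_scale c f = (\<lambda>x. c * f x)"

lemma vector_space_fun_scale: "vector_space fun_scale"
  by unfold_locales (auto simp: fun_scale_def fun_eq_iff algebra_simps)

definition sph_dim :: "nat \<Rightarrow> nat" where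
  "sph_dim n = vector_space.dim fun_scale (sph_poly n)"

definition sup_norm :: "(real^3) set \<Rightarrow> (real^3 \<Rightarrow> real) \<Rightarrow> real" where
  "sup_norm A f = (SUP x\<in>A. \<bar>f x\<bar>)"


section \<open>Coverings and polynomial meshes\<close>

definition covering_radius :: "(real^3) set \<Rightarrow> real" where
  "covering_radius Y = (SUP x\<in>S2. Min (dist x ` Y))"

definition good_covering :: "(nat \<Rightarrow> (real^3) set) \<Rightarrow> real \<Rightarrow> bool" where
  "good_covering X \<alpha> \<longleftrightarrow> \<alpha> > 0 \<and>
     (\<forall>M\<ge>2. finite (X M) \<and> X M \<subseteq> S2 \<and> card (X M) = M \<and>
            covering_radius (X M) \<le> \<alpha> / sqrt (real M))"

text \<open>Meshes are indexed by degrees \<open>n \<ge> 1\<close>. The sets are required to be nonempty because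
  the supremum over the empty set is unspecified.\<close>

definition optimal_mesh :: "(nat \<Rightarrow> (real^3) set) \<Rightarrow> real \<Rightarrow> bool" where
  "optimal_mesh A C \<longleftrightarrow>
     (\<forall>n\<ge>1. finite (A n) \<and> A n \<noteq> {} \<and> A n \<subseteq> S2 \<and>
            (\<forall>p\<in>sph_poly n. sup_norm S2 p \<le> C * sup_norm (A n) p)) \<and>
     (\<lambda>n. real (card (A n))) \<in> O(\<lambda>n. real (sph_dim n))"

definition weakly_admissible_mesh :: "(nat \<Rightarrow> (real^3) set) \<Rightarrow> (nat \<Rightarrow> real) \<Rightarrow> bool" where
  "weakly_admissible_mesh A C \<longleftrightarrow>
     (\<forall>n\<ge>1. finite (A n) \<and> A n \<noteq> {} \<and> A n \<subseteq> S2 \<and>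
            (\<forall>p\<in>sph_poly n. sup_norm S2 p \<le> C n * sup_norm (A n) p)) \<and>
     (\<exists>\<beta>\<ge>1. (\<lambda>n. real (card (A n))) \<in> O(\<lambda>n. real (sph_dim n) powr \<beta>)) \<and>
     (\<forall>r>1. C \<in> O(\<lambda>n. r ^ n))"


section \<open>Caratheodory--Tchakaloff submeshes and weighted least squares\<close>

text \<open>\<open>T\<close> is the set of nodes and \<open>w t\<close> the weight of the node \<open>t\<close>; exactness degree \<open>2 * n\<close>.\<close>

definition ct_submesh ::
    "nat \<Rightarrow> (real^3) set \<Rightarrow> (real^3) set \<Rightarrow> (real^3 \<Rightarrow> real) \<Rightarrow> bool" where
  "ct_submesh n A T w \<longleftrightarrow>
     T \<subseteq> A \<and> finite T \<and> card T \<le> sph_dim (2 * n) \<and> (\<forall>t\<in>T. w t > 0) \<and>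
     (\<forall>p\<in>poly3 (2 * n). (\<Sum>x\<in>A. p x) = (\<Sum>t\<in>T. w t * p t))"

definition is_wls ::
    "nat \<Rightarrow> (real^3) set \<Rightarrow> (real^3 \<Rightarrow> real) \<Rightarrow> (real^3 \<Rightarrow> real) \<Rightarrow> (real^3 \<Rightarrow> real) \<Rightarrow> bool" where
  "is_wls n T w f =
     is_arg_min (\<lambda>p. \<Sum>t\<in>T. w t * (f t - p t)\<^sup>2) (\<lambda>p. p \<in> sph_poly n)"

definition wls :: "nat \<Rightarrow> (real^3) set \<Rightarrow> (real^3 \<Rightarrow> real) \<Rightarrow> (real^3 \<Rightarrow> real) \<Rightarrow> real^3 \<Rightarrow> real" where
  "wls n T w f = (THE p. is_wls n T w f p)"

text \<open>The function \<open>p\<close> is an element of best uniform approximation to \<open>f\<close> on the sphere.\<close>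

definition is_best_approx :: "nat \<Rightarrow> (real^3 \<Rightarrow> real) \<Rightarrow> (real^3 \<Rightarrow> real) \<Rightarrow> bool" where
  "is_best_approx n f =
     is_arg_min (\<lambda>p. sup_norm S2 (\<lambda>x. f x - p x)) (\<lambda>p. p \<in> sph_poly n)"

definition mesh_sigma :: "real \<Rightarrow> real \<Rightarrow> nat \<Rightarrow> real" where
  "mesh_sigma \<alpha> \<theta> n = 2 * pi * \<alpha> / (\<theta> * (2 * pi - \<theta> / real n))"

definition mesh_card :: "real \<Rightarrow> real \<Rightarrow> nat \<Rightarrow> nat" where
  "mesh_card \<alpha> \<theta> n = nat \<lceil>(mesh_sigma \<alpha> \<theta> n)\<^sup>2 * (real n)\<^sup>2\<rceil>"

definition mesh_const :: "real \<Rightarrow> real \<Rightarrow> nat \<Rightarrow> real" where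
  "mesh_const \<alpha> \<theta> n = mesh_sigma \<alpha> \<theta> n * real n / (1 - \<theta>)"


section \<open>Zonal equal area configurations\<close>

definition region_area :: "nat \<Rightarrow> real" where
  "region_area M = 4 * pi / real M"

text \<open>Area of the spherical cap of spherical radius \<open>t\<close>.\<close>

definition cap_area :: "real \<Rightarrow> real" where
  "cap_area t = 2 * pi * (1 - cos t)"

definition polar_radius :: "nat \<Rightarrow> real" where
  "polar_radius M = 2 * arcsin (1 / sqrt (real M))"

definition num_collars :: "nat \<Rightarrow> nat" where
  "num_collars M = (if M = 2 then 0
     else max 1 (nat (round ((pi - 2 * polar_radius M) / sqrt (region_area M)))))"

definition collar_angle :: "nat \<Rightarrow> real" where
  "collar_angle M = (pi - 2 * polar_radius M) / real (num_collars M)"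

definition ideal_regions :: "nat \<Rightarrow> nat \<Rightarrow> real" where
  "ideal_regions M i =
     (cap_area (polar_radius M + real i * collar_angle M) -
      cap_area (polar_radius M + (real i - 1) * collar_angle M)) / region_area M"

primrec discrepancy :: "nat \<Rightarrow> nat \<Rightarrow> real" where
  "discrepancy M 0 = 0"
| "discrepancy M (Suc i) = discrepancy M i +
     (ideal_regions M (Suc i) - of_int (round (ideal_regions M (Suc i) + discrepancy M i)))"

definition num_regions :: "nat \<Rightarrow> nat \<Rightarrow> nat" where
  "num_regions M i = nat (round (ideal_regions M i + discrepancy M (i - 1)))"

definition collar_colat :: "nat \<Rightarrow> nat \<Rightarrow> real" where
  "collar_colat M i = (if i = 0 then polar_radius M
     else (THE t. 0 \<le> t \<and> t \<le> pi \<and>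
        cap_area t = (1 + real (\<Sum>j=1..i. num_regions M j)) * region_area M))"

definition sph_point :: "real \<Rightarrow> real \<Rightarrow> real^3" where
  "sph_point colat lon = vector [sin colat * cos lon, sin colat * sin lon, cos colat]"

text \<open>\<open>\<phi> i\<close> is the longitude at which the first sector of the \<open>i\<close>-th collar begins; the
  offsets are left arbitrary.\<close>

definition zonal_points :: "nat \<Rightarrow> (nat \<Rightarrow> real) \<Rightarrow> (real^3) set" where
  "zonal_points M \<phi> = {sph_point 0 0, sph_point pi 0} \<union>
     {sph_point ((collar_colat M (i - 1) + collar_colat M i) / 2)
                (\<phi> i + 2 * pi * (real j + 1 / 2) / real (num_regions M i)) | i j.
        i \<in> {1..num_collars M} \<and> j < num_regions M i}"

definition zonal_equal_area :: "nat \<Rightarrow> (real^3) set \<Rightarrow> bool" where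
  "zonal_equal_area M Y \<longleftrightarrow> (\<exists>\<phi>. Y = zonal_points M \<phi>)"

definition zonal_mesh_card :: "nat \<Rightarrow> nat" where
  "zonal_mesh_card n = nat \<lceil>49 * (real n - 1 / (4 * pi))\<^sup>2\<rceil>"

definition zonal_mesh_const :: "nat \<Rightarrow> real" where
  "zonal_mesh_const n = 14 * real n / (1 - 1 / (4 * pi * real n))"

end

theory Submission
  imports Defs "HOL-Real_Asymp.Real_Asymp"
begin

text \<open>On a great circle a polynomial of degree $n$ is a trigonometric polynomial of degree $n$.
  Bernstein's inequality, applied twice and combined with a Taylor expansion at a point where
  $|p|$ is maximal, gives $|p| \geq (1 - \frac12 (ns)^2) \max |p|$ at arc distance $s$ from that
  point; hence a covering of radius $\theta/n$ is a mesh with constant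
  $1/\kappa$, $\kappa = 1 - \frac{18}{25}\theta^2$.
  If $T$ is a Caratheodory--Tchakaloff submesh of $Y$ with weights $w$, exactness for $p^2$ gives
  $\max_Y p^2 \leq \sum_Y p^2 = \sum_T w p^2 \leq \mathrm{card}(Y) \max_T p^2$, and the weighted
  least squares projection does not increase the weighted norm; so $\sqrt{\mathrm{card}(Y)}/\kappa$
  bounds both the mesh constant of $T$ and the projection.
  Since $\kappa > 1 - \theta$, there is room for the upward rounding of the cardinality, and for the
  zonal cardinality $\lceil 49 (n - 1/(4\pi))^2 \rceil$, which is smaller than
  $\lceil \sigma_n^2 n^2 \rceil = \lceil 49 n^2/(1 - 1/(4\pi n))^2 \rceil$.\<close>

section \<open>Bernstein's inequality for trigonometric polynomials\<close>

text \<open>In this argument the slack in \<kappa> is essential. C_n is exactly \<sigma>_n n / (1 -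
  \<theta>), but the cardinality is the ceiling of \<sigma>_n^2 n^2, so with a mesh constant 1/(1 -
  \<theta>) the bound sqrt(card)/(1 - \<theta>) would exceed C_n whenever the ceiling is proper. One
  use of Bernstein's inequality loses a term linear in the radius; the derivative along the circle
  vanishes at a maximum of |p|, which is why a second use makes the loss quadratic. The covering
  radius measures chords while Bernstein's inequality measures arcs: an arc is at most 6/5 times its
  chord when the chord is at most 1, and 18/25 = (6/5)^2 / 2. Two existence claims are part of the
  conclusion: the minimum over polynomials is attained, and the weighted least squares problem has
  exactly one solution. Both minimizers come from a single lemma on seminorms, and uniqueness is the
  case \<beta> = 0 of the estimate behind the mesh property and the error bound.\<close>

definition trig_poly :: "nat \<Rightarrow> (real \<Rightarrow> complex) \<Rightarrow> bool" where
  "trig_poly n f \<longleftrightarrow>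
     (\<exists>P. degree P \<le> 2 * n \<and> (\<forall>u. f u = poly P (cis u) * cis (- (real n * u))))"

lemma trig_poly_const: "trig_poly 0 (\<lambda>u. c)"
  unfolding trig_poly_def by (rule exI[of _ "[:c:]"]) auto

lemma trig_poly_mult:
  assumes "trig_poly a f" "trig_poly b g"
  shows "trig_poly (a + b) (\<lambda>u. f u * g u)"
proof -
  obtain P Q where "degree P \<le> 2 * a" "\<And>u. f u = poly P (cis u) * cis (- (real a * u))"
    "degree Q \<le> 2 * b" "\<And>u. g u = poly Q (cis u) * cis (- (real b * u))"
    using assms unfolding trig_poly_def by blast
  moreover have "cis (- (real (a + b) * u)) = cis (- (real a * u)) * cis (- (real b * u))" for u
    by (simp add: cis_mult algebra_simps)
  ultimately show ?thesis
    unfolding trig_poly_def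
    by (intro exI[of _ "P * Q"]) (auto simp: mult_ac intro: order.trans[OF degree_mult_le])
qed

lemma trig_poly_add:
  assumes "trig_poly n f" "trig_poly n g"
  shows "trig_poly n (\<lambda>u. f u + g u)"
proof -
  obtain P Q where "degree P \<le> 2 * n" "\<And>u. f u = poly P (cis u) * cis (- (real n * u))"
    "degree Q \<le> 2 * n" "\<And>u. g u = poly Q (cis u) * cis (- (real n * u))"
    using assms unfolding trig_poly_def by blast
  then show ?thesis
    unfolding trig_poly_def
    by (intro exI[of _ "P + Q"]) (auto simp: algebra_simps intro: degree_add_le)
qed

lemma trig_poly_sum:
  assumes "\<And>i. i \<in> I \<Longrightarrow> trig_poly n (f i)"
  shows "trig_poly n (\<lambda>u. \<Sum>i\<in>I. f i u)"
  using assms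
proof (induction I rule: infinite_finite_induct)
  case (insert i I)
  then show ?case by (simp add: trig_poly_add)
qed (auto simp: trig_poly_def intro!: exI[of _ 0])

lemma trig_poly_power:
  "trig_poly a f \<Longrightarrow> trig_poly (a * k) (\<lambda>u. f u ^ k)"
  by (induction k) (use trig_poly_const in \<open>auto dest: trig_poly_mult\<close>)

text \<open>\<open>trig_poly n\<close> stores the frequencies -n, ..., n as the powers 0, ..., 2n of
  one polynomial. Raising the degree therefore shifts coefficients, which amounts to multiplying by
  1 = z^(b-a) e^(-i(b-a)u) with z = e^(iu).\<close>

lemma trig_poly_mono:
  assumes "trig_poly a f" "a \<le> b"
  shows "trig_poly b f"
proof -
  have "trig_poly (b - a) (\<lambda>u. 1)"
    unfolding trig_poly_def
    by (rule exI[of _ "monom 1 (b - a)"])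
       (auto simp: poly_monom degree_monom_eq Complex.DeMoivre cis_mult)
  from trig_poly_mult[OF assms(1) this] show ?thesis using assms(2) by simp
qed

lemma trig_poly_cos_sin:
  "trig_poly 1 (\<lambda>u. of_real (a * cos u + b * sin u))"
proof -
  define P where "P = [: Complex (a/2) (b/2), 0, Complex (a/2) (-b/2) :]"
  have "of_real (a * cos u + b * sin u) = poly P (cis u) * cis (- u)" for u
  proof -
    have "poly P (cis u) * cis (- u) =
      Complex (a/2) (b/2) * cis (-u) + Complex (a/2) (-b/2) * (cis u * cis u * cis (-u))"
      by (simp add: P_def algebra_simps)
    also have "cis u * cis u * cis (-u) = cis u" by (simp add: cis_mult)
    finally show ?thesis by (simp add: complex_eq_iff)
  qed
  then show ?thesis unfolding trig_poly_def
    by (intro exI[of _ P]) (auto simp: P_def)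
qed

text \<open>A geometric sum with ratio q = e^(i l pi/n), where q^(2n) = 1. In the given range q = 1
  only for l = 0 and l = 2n; the half-step offset of the nodes turns the second value into -2n. The
  range covers all frequencies n + m + a - b with |m| \<le> n and a, b < n.\<close>

lemma sum_cis_riesz_nodes:
  fixes l :: int
  assumes n: "n \<ge> 1" and l: "- 2 * int n < l" "l < 4 * int n"
  shows "(\<Sum>k<2*n. cis (of_int l * ((2 * real k + 1) * pi / (2 * real n)))) =
         (if l = 0 then of_nat (2 * n) else if l = 2 * int n then - of_nat (2 * n) else 0)"
proof -
  define q where "q = cis (of_int l * pi / real n)"
  have term_eq: "cis (of_int l * ((2 * real k + 1) * pi / (2 * real n))) =
    cis (of_int l * pi / (2 * real n)) * q ^ k" for k
    using n by (simp add: q_def Complex.DeMoivre cis_mult field_simps)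
  have S: "(\<Sum>k<2*n. cis (of_int l * ((2 * real k + 1) * pi / (2 * real n)))) =
    cis (of_int l * pi / (2 * real n)) * (\<Sum>k<2*n. q ^ k)"
    by (simp only: term_eq sum_distrib_left)
  consider "l = 0" | "l = 2 * int n" | "l \<noteq> 0" "l \<noteq> 2 * int n" by blast
  then show ?thesis
  proof cases
    case 1 then show ?thesis by simp
  next
    case 2
    then have "q = 1" using n by (simp add: q_def)
    moreover have "of_int l * pi / (2 * real n) = pi" using 2 n by simp
    ultimately show ?thesis using S 2 n by simp
  next
    case 3
    have "q \<noteq> 1"
    proof
      assume "q = 1"
      then have "cos (of_int l * pi / real n) = 1" by (simp add: q_def complex_eq_iff)
      then obtain j :: int where j: "of_int l * pi / real n = of_int j * 2 * pi"
        using cos_one_2pi_int by auto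
      then have "real_of_int l = of_int (j * 2 * int n)" using n by (simp add: field_simps)
      then have "l = j * (2 * int n)" by (simp only: of_int_eq_iff mult_ac)
      then have *: "- 1 * (2 * int n) < j * (2 * int n)" "j * (2 * int n) < 2 * (2 * int n)"
        using l by (simp_all only:)
      have "- 1 < j" "j < 2"
        by (rule mult_right_less_imp_less[OF *(1)], simp) (rule mult_right_less_imp_less[OF *(2)],
          simp)
      then have "j = 0 \<or> j = 1" by auto
      with 3 \<open>l = j * (2 * int n)\<close> show False by auto
    qed
    moreover have "q ^ (2 * n) = 1"
    proof -
      have "q ^ (2*n) = cis (2 * pi * of_int l)" using n
        by (simp add: q_def Complex.DeMoivre field_simps)
      then show ?thesis by (simp add: cis_multiple_2pi)
    qed
    ultimately show ?thesis using S 3 by (simp add: geometric_sum)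
  qed
qed

text \<open>These counts are the Fejer kernel coefficients; truncated subtraction supplies the 0 for
  d \<ge> n.\<close>

lemma card_pairs_diff:
  "card {(a, b). a < n \<and> b < n \<and> b = a + d} = n - (d::nat)"
proof -
  have "{(a, b). a < n \<and> b < n \<and> b = a + d} = (\<lambda>a. (a, a + d)) ` {..<n - d}"
    by auto
  then show ?thesis by (simp add: card_image inj_on_def)
qed

text \<open>M. Riesz's interpolation formula: at the $2n$ zeros $x_k$ of $\cos n x$, the weights
  $W_k = e^{i n x_k} |\sum_{a<n} e^{i a x_k}|^2$ are $n \sin (n x_k)$ times Fejer kernel values, up to
  a factor $i$, and $\sum_k W_k f(u + x_k) = 2 n i f'(u)$.\<close>

context
  fixes n :: nat and x :: "nat \<Rightarrow> real" and W :: "nat \<Rightarrow> complex"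
  assumes n: "n \<ge> 1"
  defines "x \<equiv> \<lambda>k. (2 * real k + 1) * pi / (2 * real n)"
  defines "W \<equiv> \<lambda>k. cis (real n * x k) * (\<Sum>a<n. cis (real a * x k)) * cnj (\<Sum>a<n. cis (real a * x k))"
begin

lemma riesz_weight_expand:
  "W k * cis (real_of_int m * x k) =
    (\<Sum>(a,b)\<in>{..<n}\<times>{..<n}. cis (of_int (int n + m + int a - int b) * x k))"
proof -
  have "W k * cis (real_of_int m * x k) =
    (\<Sum>a<n. \<Sum>b<n. cis (real a * x k) * cnj (cis (real b * x k)) * (cis (real n * x k) *
      cis (real_of_int m * x k)))"
    unfolding W_def cnj_sum by (simp add: sum_product sum_distrib_left sum_distrib_right mult_ac)
  also have "\<dots> = (\<Sum>a<n. \<Sum>b<n. cis (of_int (int n + m + int a - int b) * x k))"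
    by (intro sum.cong refl) (simp add: cis_cnj cis_mult algebra_simps)
  finally show ?thesis by (simp add: sum.cartesian_product)
qed

text \<open>Summing over the nodes leaves only the pairs with frequency 0, that is b = a + (n + m),
  and with frequency 2n, that is a = b + (n - m). They contribute 2n max(0, -m) and -2n max(0, m),
  whose sum is -2nm.\<close>

lemma riesz_formula_exp:
  assumes m: "\<bar>m\<bar> \<le> int n"
  shows "(\<Sum>k<2*n. W k * cis (real_of_int m * x k)) = - of_int (2 * int n * m)"
proof -
  define S where "S l = (if l = 0 then of_nat (2 * n) else
    if l = 2 * int n then - of_nat (2 * n) else 0 :: complex)" for l
  have "(\<Sum>k<2*n. W k * cis (real_of_int m * x k)) =
     (\<Sum>(a,b)\<in>{..<n}\<times>{..<n}. \<Sum>k<2*n. cis (of_int (int n + m + int a - int b) * x k))"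
    by (simp add: riesz_weight_expand sum.swap[of _ _ "{..<2*n}"] case_prod_unfold)
  also have "\<dots> = (\<Sum>(a,b)\<in>{..<n}\<times>{..<n}. S (int n + m + int a - int b))"
    unfolding S_def x_def
    by (intro sum.cong refl, clarify, rule sum_cis_riesz_nodes) (use n m in auto)
  also have "\<dots> = of_nat (2 * n) * (\<Sum>(a,b)\<in>{..<n}\<times>{..<n}. of_bool (b = a + nat (int n + m)))
                - of_nat (2 * n) * (\<Sum>(a,b)\<in>{..<n}\<times>{..<n}. of_bool (a = b + nat (int n - m)))"
    unfolding sum_distrib_left sum_subtractf [symmetric]
    by (intro sum.cong refl) (use n m in \<open>auto simp: S_def\<close>)
  also have "(\<Sum>(a,b)\<in>{..<n}\<times>{..<n}. of_bool (b = a + nat (int n + m))) =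
      (of_nat (card {(a, b). a < n \<and> b < n \<and> b = a + nat (int n + m)}) :: complex)"
    by (simp add: case_prod_unfold sum_of_bool_eq Int_def) (rule arg_cong[of _ _ card], auto)
  also have "(\<Sum>(a,b)\<in>{..<n}\<times>{..<n}. of_bool (a = b + nat (int n - m))) =
      (\<Sum>(b,a)\<in>{..<n}\<times>{..<n}. of_bool (a = b + nat (int n - m)) :: complex)"
    unfolding sum.cartesian_product[symmetric] by (rule sum.swap)
  also have "(\<Sum>(b,a)\<in>{..<n}\<times>{..<n}. of_bool (a = b + nat (int n - m))) =
      (of_nat (card {(b, a). b < n \<and> a < n \<and> a = b + nat (int n - m)}) :: complex)"
    by (simp add: case_prod_unfold sum_of_bool_eq Int_def) (rule arg_cong[of _ _ card], auto)
  also have "of_nat (2 * n) * of_nat (card {(a, b). a < n \<and> b < n \<and> b = a + nat (int n + m)}) -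
     of_nat (2 * n) * of_nat (card {(b, a). b < n \<and> a < n \<and> a = b + nat (int n - m)}) =
     (of_int (2 * int n * (int (n - nat (int n + m)) - int (n - nat (int n - m)))) :: complex)"
    unfolding card_pairs_diff by (simp add: algebra_simps)
  also have "int (n - nat (int n + m)) - int (n - nat (int n - m)) = - m"
    using m by auto
  finally show ?thesis by simp
qed

text \<open>Discrete orthogonality removes all pairs a \<noteq> b from the squared exponential sum,
  and each of the n diagonal pairs gives 2n. This value of the total weight is what makes the
  constant in Bernstein's inequality equal to n.\<close>

lemma riesz_weight_norm: "(\<Sum>k<2*n. norm (W k)) = 2 * real n * real n"
proof -
  have "of_real (norm (W k)) = (\<Sum>(a,b)\<in>{..<n}\<times>{..<n}. cis (of_int (int a - int b) * x k))" for k
  proof -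
    have "of_real (norm (W k)) = (\<Sum>a<n. cis (real a * x k)) * cnj (\<Sum>a<n. cis (real a * x k))"
      by (simp only: W_def norm_mult complex_mod_cnj norm_cis mult_1 complex_norm_square
        [symmetric] power2_eq_square of_real_mult)
    also have "\<dots> = (\<Sum>a<n. \<Sum>b<n. cis (of_int (int a - int b) * x k))"
      unfolding cnj_sum sum_product
        by (intro sum.cong refl) (simp add: cis_cnj cis_mult algebra_simps)
    finally show ?thesis by (simp add: sum.cartesian_product)
  qed
  then have "of_real (\<Sum>k<2*n. norm (W k)) =
     (\<Sum>(a,b)\<in>{..<n}\<times>{..<n}. \<Sum>k<2*n. cis (of_int (int a - int b) * x k))"
    by (simp add: sum.swap[of _ _ "{..<2*n}"] case_prod_unfold)
  also have "\<dots> = (\<Sum>(a,b)\<in>{..<n}\<times>{..<n}. if a = b then of_nat (2 * n) else 0)"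
    unfolding x_def
    by (intro sum.cong refl, clarify, subst sum_cis_riesz_nodes) (use n in auto)
  also have "\<dots> = (\<Sum>a<n. \<Sum>b<n. if a = b then of_nat (2 * n) else 0)"
    by (simp only: sum.cartesian_product)
  also have "\<dots> = of_real (2 * real n * real n)" by simp
  finally show ?thesis by (simp only: of_real_eq_iff)
qed

text \<open>Differentiation multiplies the coefficient of e^(i(l-n)u) by i(l-n), and zP' - nP has
  the coefficients (l-n) P_l; this gives \<open>g\<close>. After multiplication by 2ni each factor
  -2n(l-n) is a sum from \<open>riesz_formula_exp\<close>, so 2ni g(u) becomes a weighted sum of
  values of f, and the triangle inequality bounds it.\<close>

lemma riesz_bernstein:
  fixes P :: "complex poly"
  assumes deg: "degree P \<le> 2 * n"
    and f: "\<And>u. f u = poly P (cis u) * cis (- (real n * u))"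
    and bd: "\<And>u. norm (f u) \<le> B"
  defines "g \<equiv> \<lambda>u. \<i> * (poly ([:0,1:] * pderiv P - of_nat n * P) (cis u)) * cis (- (real n * u))"
  shows "(f has_vector_derivative g u) (at u)" "trig_poly n g" "norm (g u) \<le> real n * B"
proof -
  have "f = (\<lambda>u. poly P (cis u) * cis (- (real n * u)))" using f by blast
  moreover have "((\<lambda>u. poly P (cis u) * cis (- (real n * u))) has_vector_derivative g u) (at u)"
  proof -
    have c: "((\<lambda>u. cis (c * u)) has_vector_derivative (\<i> * c * cis (c * u))) (at u)" for c :: real
      unfolding has_vector_derivative_complex_iff
      by (auto intro!: derivative_eq_intros simp: algebra_simps)
    have d: "((poly P \<circ> cis) has_vector_derivative (\<i> * cis u * poly (pderiv P) (cis u))) (at u)"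
      by (rule field_vector_diff_chain_at) (use c[of 1] in \<open>auto intro: poly_DERIV\<close>)
    show ?thesis
      using has_vector_derivative_mult[OF d c[of "- real n"]]
      by (simp add: g_def algebra_simps)
  qed
  ultimately show "(f has_vector_derivative g u) (at u)" by simp
  define R where "R = [:0,1:] * pderiv P - of_nat n * P"
  have "degree ([:0,1:] * pderiv P) \<le> 2 * n"
    using degree_mult_le[of "[:0,1:]" "pderiv P"] deg n by (auto simp: degree_pderiv)
  moreover have "degree (of_nat n * P) \<le> 2 * n" using deg
    by (simp add: of_nat_poly degree_smult_le order_trans)
  ultimately have degR: "degree R \<le> 2 * n"
    unfolding R_def by (intro degree_diff_le)
  have coeffR: "coeff R l = of_int (int l - int n) * coeff P l" for l
    by (cases l) (auto simp: R_def coeff_pderiv of_nat_poly algebra_simps)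
  show "trig_poly n g"
    unfolding trig_poly_def g_def R_def[symmetric]
    by (intro exI[of _ "smult \<i> R"]) (use degR degree_smult_le[of \<i> R] in auto)
  have expand: "poly Q (cis v) * cis (- (real n * v)) =
    (\<Sum>l\<le>2*n. coeff Q l * cis (of_int (int l - int n) * v))"
    if "degree Q \<le> 2 * n" for Q v
  proof -
    have "poly Q (cis v) = (\<Sum>l\<le>2*n. coeff Q l * cis v ^ l)"
      unfolding poly_altdef using that
      by (intro sum.mono_neutral_left) (auto intro: coeff_eq_0)
    then show ?thesis
      by (simp add: sum_distrib_right Complex.DeMoivre cis_mult mult.assoc)
         (simp add: algebra_simps)
  qed
  have fsum: "f v = (\<Sum>l\<le>2*n. coeff P l * cis (of_int (int l - int n) * v))" for v
    unfolding f by (rule expand) (fact deg)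
  have "g u = \<i> * (\<Sum>l\<le>2*n. coeff R l * cis (of_int (int l - int n) * u))"
    unfolding g_def R_def[symmetric] by (simp only: mult.assoc expand[OF degR])
  also have "\<dots> = (\<Sum>l\<le>2*n. \<i> * of_int (int l - int n) * coeff P l * cis (of_int (int l - int n) * u))"
    by (simp only: coeffR sum_distrib_left mult_ac)
  also have "of_real (2 * real n) * \<i> * \<dots> =
    (\<Sum>l\<le>2*n. coeff P l * cis (of_int (int l - int n) * u) * (- of_int (2 * int n * (int l - int n))))"
    unfolding sum_distrib_left by (intro sum.cong refl) (simp add: algebra_simps)
  also have "\<dots> = (\<Sum>l\<le>2*n. coeff P l * cis (of_int (int l -
    int n) * u) * (\<Sum>k<2*n. W k * cis (of_int (int l - int n) * x k)))"
    by (intro sum.cong refl, subst riesz_formula_exp) auto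
  also have "\<dots> = (\<Sum>k<2*n. W k * f (u + x k))"
    unfolding fsum sum_distrib_left
    by (subst sum.swap, intro sum.cong refl) (simp add: cis_mult algebra_simps)
  finally have *: "of_real (2 * real n) * \<i> * g u = (\<Sum>k<2*n. W k * f (u + x k))" .
  have "2 * real n * norm (g u) = norm (of_real (2 * real n) * \<i> * g u)"
    by (simp add: norm_mult)
  also have "\<dots> \<le> (\<Sum>k<2*n. norm (W k) * B)"
    unfolding * by (intro sum_norm_le) (simp add: norm_mult bd mult_left_mono)
  also have "\<dots> = 2 * real n * (real n * B)"
    by (simp add: sum_distrib_right[symmetric] riesz_weight_norm)
  finally show "norm (g u) \<le> real n * B" using n by simp
qed

end

text \<open>The derivative is returned together with its being a trigonometric polynomial of the
  same degree, so that the theorem can be applied to it again.\<close>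

theorem bernstein_trig_poly:
  assumes "n \<ge> 1" "trig_poly n f" "\<And>u. norm (f u) \<le> B"
  obtains g where "trig_poly n g" "\<And>u. (f has_vector_derivative g u) (at u)"
    "\<And>u. norm (g u) \<le> real n * B"
proof -
  obtain P where "degree P \<le> 2 * n" "\<And>u. f u = poly P (cis u) * cis (- (real n * u))"
    using assms(2) unfolding trig_poly_def by blast
  from riesz_bernstein[OF assms(1) this assms(3)] that show ?thesis by blast
qed

section \<open>Polynomials on great circles\<close>

lemma finite_multi_indices [simp]: "finite {(i, j, k). i + j + k \<le> (n::nat)}"
  by (rule finite_subset[of _ "{..n} \<times> {..n} \<times> {..n}"]) auto

lemma poly3_monom:
  assumes "i + j + k \<le> n"
  shows "(\<lambda>x. c * x$1 ^ i * x$2 ^ j * x$3 ^ k) \<in> poly3 n"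
proof -
  have "c * x$1 ^ i * x$2 ^ j * x$3 ^ k =
    (\<Sum>(a,b,d)\<in>{(a,b,d). a + b + d \<le> n}. (if (a,b,d) =
      (i,j,k) then c else 0) * x$1 ^ a * x$2 ^ b * x$3 ^ d)" for x :: "real^3"
  proof -
    have "(\<Sum>(a,b,d)\<in>{(a,b,d). a + b + d \<le> n}. (if (a,b,d) =
      (i,j,k) then c else 0) * x$1 ^ a * x$2 ^ b * x$3 ^ d)
      = (\<Sum>s\<in>{(a,b,d). a + b + d \<le> n}. if s = (i,j,k) then c * x$1 ^ i * x$2 ^ j * x$3 ^ k else 0)"
      by (intro sum.cong refl) (auto split: if_splits)
    then show ?thesis using assms by simp
  qed
  then show ?thesis unfolding poly3_def
    by (intro CollectI exI[of _ "\<lambda>a b d. if (a,b,d) = (i,j,k) then c else 0"]) (auto simp: fun_eq_iff)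
qed

lemma poly3_add:
  assumes "p \<in> poly3 n" "q \<in> poly3 n"
  shows "(\<lambda>x. p x + q x) \<in> poly3 n"
proof -
  obtain c d where "p = (\<lambda>x. \<Sum>(i,j,k)\<in>{(i,j,k). i + j + k \<le>
    n}. c i j k * x$1 ^ i * x$2 ^ j * x$3 ^ k)"
   "q = (\<lambda>x. \<Sum>(i,j,k)\<in>{(i,j,k). i + j + k \<le> n}. d i j k * x$1 ^ i * x$2 ^ j * x$3 ^ k)"
    using assms unfolding poly3_def by blast
  then show ?thesis unfolding poly3_def
    by (intro CollectI exI[of _ "\<lambda>i j k. c i j k + d i j k"])
      (auto simp: fun_eq_iff sum.distrib[symmetric] distrib_right intro!: sum.cong)
qed

lemma poly3_sum:
  "(\<And>i. i \<in> I \<Longrightarrow> f i \<in> poly3 n) \<Longrightarrow> (\<lambda>x. \<Sum>i\<in>I. f i x) \<in> poly3 n"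
proof (induction I rule: infinite_finite_induct)
  case (insert i I)
  then show ?case by (simp add: poly3_add)
qed (use poly3_monom[of 0 0 0 n 0] in auto)

lemma poly3_mult:
  assumes "p \<in> poly3 m" "q \<in> poly3 n"
  shows "(\<lambda>x. p x * q x) \<in> poly3 (m + n)"
proof -
  obtain c d where p: "p = (\<lambda>x. \<Sum>(i,j,k)\<in>{(i,j,k). i + j + k \<le>
    m}. c i j k * x$1 ^ i * x$2 ^ j * x$3 ^ k)"
   and q: "q = (\<lambda>x. \<Sum>(i,j,k)\<in>{(i,j,k). i + j + k \<le> n}. d i j k * x$1 ^ i * x$2 ^ j * x$3 ^ k)"
    using assms unfolding poly3_def by blast
  have "(\<lambda>x. p x * q x) = (\<lambda>x. \<Sum>s\<in>{(i,j,k). i + j + k \<le> m}. \<Sum>t\<in>{(i,j,k). i + j + k \<le> n}.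
     (case s of (i,j,k) \<Rightarrow> case t of (i',j',k') \<Rightarrow>
        (c i j k * d i' j' k') * x$1 ^ (i + i') * x$2 ^ (j + j') * x$3 ^ (k + k')))"
    unfolding p q sum_product
    by (intro ext sum.cong refl) (auto simp: power_add mult_ac)
  also have "\<dots> \<in> poly3 (m + n)"
    by (intro poly3_sum, clarsimp) (rule poly3_monom, auto)
  finally show ?thesis .
qed

lemma poly3_scale: "p \<in> poly3 n \<Longrightarrow> (\<lambda>x. c * p x) \<in> poly3 n"
  using poly3_mult[OF poly3_monom[of 0 0 0 0 c]] by auto

lemma continuous_on_poly3: "p \<in> poly3 n \<Longrightarrow> continuous_on S p"
  unfolding poly3_def by (auto simp: case_prod_unfold intro!: continuous_intros)

lemma sph_polyE:
  assumes "p \<in> sph_poly n"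
  obtains P where "P \<in> poly3 n" "\<And>x. x \<in> S2 \<Longrightarrow> p x = P x" "\<And>x. x \<notin> S2 \<Longrightarrow> p x = 0"
  using assms unfolding sph_poly_def by auto

lemma sph_polyI:
  "P \<in> poly3 n \<Longrightarrow> (\<lambda>x. if x \<in> S2 then P x else 0) \<in> sph_poly n"
  unfolding sph_poly_def by auto

lemma sph_poly_add:
  assumes "p \<in> sph_poly n" "q \<in> sph_poly n"
  shows "(\<lambda>x. p x + q x) \<in> sph_poly n"
proof -
  obtain P Q where *: "P \<in> poly3 n" "Q \<in> poly3 n"
    "p = (\<lambda>x. if x \<in> S2 then P x else 0)" "q = (\<lambda>x. if x \<in> S2 then Q x else 0)"
    using assms unfolding sph_poly_def by auto
  have "(\<lambda>x. p x + q x) = (\<lambda>x. if x \<in> S2 then P x + Q x else 0)"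
    unfolding * by auto
  then show ?thesis using sph_polyI[OF poly3_add[OF *(1,2)]] by simp
qed

lemma sph_poly_scale:
  assumes "p \<in> sph_poly n"
  shows "(\<lambda>x. c * p x) \<in> sph_poly n"
proof -
  obtain P where *: "P \<in> poly3 n" "p = (\<lambda>x. if x \<in> S2 then P x else 0)"
    using assms unfolding sph_poly_def by auto
  have "(\<lambda>x. c * p x) = (\<lambda>x. if x \<in> S2 then c * P x else 0)"
    unfolding * by auto
  then show ?thesis using sph_polyI[OF poly3_scale[OF *(1)]] by simp
qed

lemma sph_poly_diff:
  "p \<in> sph_poly n \<Longrightarrow> q \<in> sph_poly n \<Longrightarrow> (\<lambda>x. p x - q x) \<in> sph_poly n"
  using sph_poly_add[of p n "\<lambda>x. (-1) * q x"] sph_poly_scale[of q n "-1"] by auto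

lemma continuous_on_sph_poly: "p \<in> sph_poly n \<Longrightarrow> continuous_on S2 p"
  by (erule sph_polyE) (metis continuous_on_cong continuous_on_poly3)

lemma trig_poly_great_circle:
  assumes "p \<in> poly3 n"
  shows "trig_poly n (\<lambda>u. of_real (p (cos u *\<^sub>R x + sin u *\<^sub>R e)))"
proof -
  obtain c where p: "p = (\<lambda>x. \<Sum>(i,j,k)\<in>{(i,j,k). i + j + k \<le>
    n}. c i j k * x$1 ^ i * x$2 ^ j * x$3 ^ k)"
    using assms unfolding poly3_def by blast
  have m: "trig_poly k (\<lambda>u. of_real ((cos u *\<^sub>R x + sin u *\<^sub>R e) $ r) ^ k)" for r k
    using trig_poly_power[OF trig_poly_cos_sin[of "x $ r" "e $ r"]] by (simp add: mult_ac)
  have "trig_poly n (\<lambda>u. of_real (c i j k * (cos u *\<^sub>R x + sin u *\<^sub>R e)$1 ^ i * (cos u *\<^sub>R x +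
    sin u *\<^sub>R e)$2 ^ j * (cos u *\<^sub>R x + sin u *\<^sub>R e)$3 ^ k))"
    if "i + j + k \<le> n" for i j k
    using trig_poly_mono[OF trig_poly_mult[OF trig_poly_mult[OF trig_poly_mult[OF trig_poly_const
      m] m] m]] that
    by simp
  then show ?thesis unfolding p of_real_sum
    by (intro trig_poly_sum) (auto simp: case_prod_unfold)
qed

lemma great_circle_lower_bound:
  assumes n: "n \<ge> 1" and p: "p \<in> poly3 n"
    and bd: "\<And>u. \<bar>p (cos u *\<^sub>R x + sin u *\<^sub>R e)\<bar> \<le> p x" and s: "s \<ge> 0"
  shows "p (cos s *\<^sub>R x + sin s *\<^sub>R e) \<ge> p x * (1 - (real n * s)\<^sup>2 / 2)"
proof -
  define t where "t u = p (cos u *\<^sub>R x + sin u *\<^sub>R e)" for u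
  have "trig_poly n (\<lambda>u. of_real (t u))" unfolding t_def by (rule trig_poly_great_circle) (fact p)
  then obtain g where g: "trig_poly n g" "\<And>u. ((\<lambda>u. of_real (t u)) has_vector_derivative g u) (at u)"
    "\<And>u. norm (g u) \<le> real n * p x"
    by (rule bernstein_trig_poly[OF n, where B = "p x"]) (use bd in \<open>auto simp: t_def\<close>)
  obtain h where "trig_poly n h" and h: "\<And>u. (g has_vector_derivative h u) (at u)"
    "\<And>u. norm (h u) \<le> real n * (real n * p x)"
    using bernstein_trig_poly[OF n g(1,3)] by blast
  have t: "(t has_real_derivative Re (g u)) (at u)" for u
    using g(2)[of u] by (simp add: has_vector_derivative_complex_iff)
  have t': "((\<lambda>u. Re (g u)) has_real_derivative Re (h u)) (at u)" for u
    using h(1)[of u] by (simp add: has_vector_derivative_complex_iff)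
  have t0: "t 0 = p x" by (simp add: t_def)
  have "Re (g 0) = 0"
    by (rule DERIV_local_max[OF t, of 1]) (use bd in \<open>auto simp: t_def abs_le_iff\<close>)
  \<comment> \<open>\<open>H\<close> is t minus the parabola that bounds it from below near its
    maximum at 0. The second Bernstein bound makes \<open>H'\<close> nondecreasing; since
    \<open>H'\<close> and \<open>H\<close> vanish at 0, both are nonnegative to the right of
    it.\<close>
  define H where "H u = t u - t 0 + real n * real n * p x * u\<^sup>2 / 2" for u
  define H' where "H' u = Re (g u) + real n * real n * p x * u" for u
  have "(H has_real_derivative H' u) (at u)" for u
    unfolding H_def H'_def by (auto intro!: derivative_eq_intros t)
  moreover have "H' u \<ge> 0" if "u \<ge> 0" for u
  proof -
    have "(H' has_real_derivative Re (h u) + real n * real n * p x) (at u)" for u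
      unfolding H'_def by (rule DERIV_add[OF t' DERIV_cmult_Id])
    moreover have "Re (h u) + real n * real n * p x \<ge> 0" for u
      using h(2)[of u] abs_Re_le_cmod[of "h u"] by (simp add: mult_ac)
    ultimately have "H' 0 \<le> H' u"
      by - (rule DERIV_nonneg_imp_nondecreasing[OF that], blast)
    then show ?thesis by (simp add: H'_def \<open>Re (g 0) = 0\<close>)
  qed
  ultimately have "H 0 \<le> H s"
    by - (rule DERIV_nonneg_imp_nondecreasing[OF s], blast)
  then show ?thesis
    by (simp add: H_def t0 algebra_simps power2_eq_square) (simp add: t_def mult_ac)
qed

section \<open>Coverings are meshes\<close>

text \<open>The bound \<open>B\<close>, absent from the conclusion, guarantees that the real
  supremum is a genuine one.\<close>

lemma sup_norm_upper:
  assumes "\<And>x. x \<in> A \<Longrightarrow> \<bar>f x\<bar> \<le> B" "x \<in> A"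
  shows "\<bar>f x\<bar> \<le> sup_norm A f"
  unfolding sup_norm_def using assms by (intro cSUP_upper bdd_aboveI2[where M = B])

lemma sup_norm_least:
  assumes "A \<noteq> {}" "\<And>x. x \<in> A \<Longrightarrow> \<bar>f x\<bar> \<le> B"
  shows "sup_norm A f \<le> B"
  unfolding sup_norm_def using assms by (rule cSUP_least)

lemma sup_norm_upper_finite:
  assumes "finite A" "x \<in> A"
  shows "\<bar>f x\<bar> \<le> sup_norm A f"
  unfolding sup_norm_def using assms by (intro cSUP_upper) auto

lemma sup_norm_attained_S2:
  assumes "continuous_on S2 f"
  obtains x where "x \<in> S2" "sup_norm S2 f = \<bar>f x\<bar>" "\<And>y. y \<in> S2 \<Longrightarrow> \<bar>f y\<bar> \<le> \<bar>f x\<bar>"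
proof -
  have "compact S2" "S2 \<noteq> {}" by auto
  moreover have "continuous_on S2 (\<lambda>x. \<bar>f x\<bar>)" using assms by (rule continuous_on_rabs)
  ultimately obtain x where x: "x \<in> S2" "\<And>y. y \<in> S2 \<Longrightarrow> \<bar>f y\<bar> \<le> \<bar>f x\<bar>"
    using continuous_attains_sup[of S2 "\<lambda>x. \<bar>f x\<bar>"] by blast
  moreover have "sup_norm S2 f = \<bar>f x\<bar>"
    using sup_norm_upper[of S2 f "\<bar>f x\<bar>" x] sup_norm_least[of S2 f "\<bar>f x\<bar>"] x \<open>S2 \<noteq> {}\<close>
    by (intro antisym) auto
  ultimately show ?thesis using that by blast
qed

lemma covering_radius_point:
  assumes "finite Y" "Y \<noteq> {}" "Y \<subseteq> S2" "x \<in> S2"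
  obtains y where "y \<in> Y" "dist x y \<le> covering_radius Y"
proof -
  have "Min (dist x ` Y) \<in> dist x ` Y" using assms by (intro Min_in) auto
  then obtain y where y: "y \<in> Y" "dist x y = Min (dist x ` Y)" by auto
  \<comment> \<open>The diameter 2 bounds the family whose supremum is the covering radius.\<close>
  have "Min (dist z ` Y) \<le> 2" if "z \<in> S2" for z
  proof -
    have "Min (dist z ` Y) \<le> dist z y" using assms y by (intro Min_le) auto
    also have "\<dots> \<le> 2" using norm_triangle_ineq4[of z y] that y assms by (auto simp: dist_norm)
    finally show ?thesis .
  qed
  then have "Min (dist x ` Y) \<le> covering_radius Y"
    unfolding covering_radius_def using assms by (intro cSUP_upper bdd_aboveI2[where M = 2])
  with y that show ?thesis by simp
qed

section \<open>Arcs of great circles and their chords\<close>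

lemma S2_great_circle:
  assumes "norm x = 1" "norm e = 1" "x \<bullet> e = 0"
  shows "cos u *\<^sub>R x + sin u *\<^sub>R e \<in> S2"
proof -
  have "(norm (cos u *\<^sub>R x + sin u *\<^sub>R e))\<^sup>2 = (cos u)\<^sup>2 * (norm x)\<^sup>2 + (sin u)\<^sup>2 * (norm e)\<^sup>2"
    using assms(3) unfolding power2_norm_eq_inner
    by (simp add: inner_add inner_commute power2_eq_square)
  also have "\<dots> = 1" using assms by simp
  finally show ?thesis by (simp add: power2_eq_1_iff) (smt (verit) norm_ge_zero)
qed

lemma S2_geodesic:
  fixes x y :: "real^3"
  assumes x: "norm x = 1" and y: "norm y = 1" and "x \<noteq> y" and d: "dist x y \<le> 1"
  obtains e s where "norm e = 1" "x \<bullet> e = 0" "0 \<le> s" "y = cos s *\<^sub>R x + sin s *\<^sub>R e"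
    "s \<le> 6 / 5 * dist x y"
proof -
  define c where "c = x \<bullet> y"
  have xx: "x \<bullet> x = 1" "y \<bullet> y = 1" using x y by (simp_all add: norm_eq_1)
  have dc: "(dist x y)\<^sup>2 = 2 - 2 * c"
    by (simp add: dist_norm power2_norm_eq_inner inner_diff c_def xx inner_commute)
  have "(dist x y)\<^sup>2 \<le> 1" using d by (simp add: power_le_one)
  then have c1: "c \<ge> 1 / 2" using dc by simp
  have "(dist x y)\<^sup>2 > 0" using \<open>x \<noteq> y\<close> by simp
  then have c2: "c < 1" using dc by simp
  define s where "s = arccos c"
  have cs: "cos s = c" using c1 c2 by (simp add: s_def)
  have s0: "0 \<le> s" "s \<le> pi" using c1 c2 by (auto simp: s_def intro: arccos_lbound arccos_ubound)
  have "c\<^sup>2 < 1" using c1 c2 by (simp add: power_less_one_iff abs_square_less_1)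
  then have "sin s \<noteq> 0" using sin_cos_squared_add[of s] cs by auto
  define e where "e = (1 / sin s) *\<^sub>R (y - c *\<^sub>R x)"
  have ye: "y = cos s *\<^sub>R x + sin s *\<^sub>R e" using \<open>sin s \<noteq> 0\<close> by (simp add: e_def cs)
  have xe: "x \<bullet> e = 0" by (simp add: e_def inner_diff xx c_def)
  have "(norm (y - c *\<^sub>R x))\<^sup>2 = 1 - c\<^sup>2"
    unfolding power2_norm_eq_inner by (simp add: inner_diff xx c_def inner_commute power2_eq_square)
  also have "\<dots> = (sin s)\<^sup>2" using sin_cos_squared_add[of s] cs by simp
  finally have "norm (y - c *\<^sub>R x) = \<bar>sin s\<bar>"
    by (metis abs_norm_cancel power2_eq_iff_nonneg real_sqrt_abs)
  then have ne: "norm e = 1" using \<open>sin s \<noteq> 0\<close> by (simp add: e_def)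
  have "s \<le> pi / 3"
    using cos_monotone_0_pi[of "pi/3" s] s0 cs c1 by (force simp: cos_60)
  then have u: "0 \<le> s / 2" "s / 2 \<le> 1" using s0 pi_less_4 by auto
  \<comment> \<open>A chord of length at most 1 has s \<le> pi/3, hence v = s/2 lies in [0, 1].
    There sin v \<ge> v - v^3/6 \<ge> 5v/6, and the chord is 2 sin v; this gives the factor
    6/5.\<close>
  have "\<bar>sin (s/2) - s/2\<bar> \<le> (s/2) ^ 3 / 6"
    using Maclaurin_sin_bound[of "s/2" 3] u
    by (simp add: sin_coeff_def numeral_eq_Suc fact_numeral abs_mult field_simps)
  moreover have "(s/2) ^ 3 \<le> s / 2" using power_decreasing[of 1 3 "s/2"] u by simp
  ultimately have "sin (s/2) \<ge> 5 / 12 * s" by linarith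
  moreover have "dist x y = 2 * sin (s/2)"
  proof -
    have "(dist x y)\<^sup>2 = (2 * sin (s/2))\<^sup>2"
      using cos_double_sin[of "s/2"] dc cs by (simp add: power_mult_distrib)
    moreover have "sin (s/2) \<ge> 0" using s0 by (intro sin_ge_zero) auto
    ultimately show ?thesis using power2_eq_iff_nonneg[of "dist x y" "2 * sin (s/2)"] by simp
  qed
  ultimately have "s \<le> 6 / 5 * dist x y" by simp
  with that ne xe s0 ye show ?thesis by blast
qed

theorem sphere_covering_mesh:
  assumes n: "n \<ge> 1" and Y: "finite Y" "Y \<noteq> {}" "Y \<subseteq> S2"
    and \<eta>: "covering_radius Y \<le> \<eta>" "\<eta> \<le> 1" and p: "p \<in> sph_poly n"
  shows "sup_norm S2 p * (1 - 18 / 25 * (real n * \<eta>)\<^sup>2) \<le> sup_norm Y p"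
proof -
  obtain x where x: "x \<in> S2" "sup_norm S2 p = \<bar>p x\<bar>" "\<And>y. y \<in> S2 \<Longrightarrow> \<bar>p y\<bar> \<le> \<bar>p x\<bar>"
    using sup_norm_attained_S2[OF continuous_on_sph_poly[OF p]] by blast
  obtain y where y: "y \<in> Y" "dist x y \<le> covering_radius Y"
    using covering_radius_point[OF Y x(1)] by blast
  note y(2) also note \<eta>(1)
  finally have y\<eta>: "dist x y \<le> \<eta>" .
  have "\<bar>p x\<bar> * (1 - 18 / 25 * (real n * \<eta>)\<^sup>2) \<le> \<bar>p y\<bar>"
  proof (cases "x = y")
    case True
    then show ?thesis by (simp add: mult_left_le)
  next
    case False
    obtain P where P: "P \<in> poly3 n" "\<And>z. z \<in> S2 \<Longrightarrow> p z = P z" using p by (elim sph_polyE) blast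
    \<comment> \<open>The sign makes the value at x positive, so that it dominates |q| on the whole
      circle, as \<open>great_circle_lower_bound\<close> demands.\<close>
    define q where "q = (\<lambda>z. (if P x \<ge> 0 then 1 else - 1) * P z)"
    have q: "q \<in> poly3 n" unfolding q_def by (rule poly3_scale) (fact P)
    have qx: "q x = \<bar>p x\<bar>" using P x by (simp add: q_def)
    have qz: "\<bar>q z\<bar> = \<bar>p z\<bar>" if "z \<in> S2" for z using P that by (simp add: q_def)
    have "norm x = 1" "norm y = 1" "dist x y \<le> 1" using x(1) y(1) Y(3) y\<eta> \<eta>(2) by auto
    then obtain e s where es: "norm e = 1" "x \<bullet> e = 0" "0 \<le> s" "y = cos s *\<^sub>R x + sin s *\<^sub>R e"
      "s \<le> 6 / 5 * dist x y"
      using S2_geodesic[of x y] False by blast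
    have circle: "cos u *\<^sub>R x + sin u *\<^sub>R e \<in> S2" for u
      by (rule S2_great_circle) (use x(1) es in auto)
    have "real n * s \<le> 6 / 5 * (real n * \<eta>)"
      using mult_left_mono[of s "6 / 5 * \<eta>" "real n"] es(5) y\<eta> by simp
    then have "(real n * s)\<^sup>2 \<le> (6 / 5 * (real n * \<eta>))\<^sup>2"
      using es(3) by (intro power_mono) auto
    then have "q x * (1 - 18 / 25 * (real n * \<eta>)\<^sup>2) \<le> q x * (1 - (real n * s)\<^sup>2 / 2)"
      using qx by (intro mult_left_mono) (auto simp: power_mult_distrib power_divide)
    also have "\<dots> \<le> q y" unfolding es(4)
      by (rule great_circle_lower_bound[OF n q _ es(3)]) (use qx qz[OF circle] x(3)[OF circle] in
        simp)
    also have "\<dots> \<le> \<bar>p y\<bar>" using qz[of y] y Y by auto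
    finally show ?thesis by (simp add: qx)
  qed
  also have "\<dots> \<le> sup_norm Y p" by (rule sup_norm_upper_finite) (use Y y in auto)
  finally show ?thesis by (simp add: x(2))
qed

section \<open>Dimension\<close>

interpretation fs: vector_space fun_scale by (rule vector_space_fun_scale)

lemma sum_fun_eval: "(\<Sum>i\<in>I. f i) x = (\<Sum>i\<in>I. f i x)"
  for f :: "'i \<Rightarrow> 'a \<Rightarrow> real"
  by (induction I rule: infinite_finite_induct) auto

definition sph_monom :: "nat \<times> nat \<times> nat \<Rightarrow> real^3 \<Rightarrow> real" where
  "sph_monom = (\<lambda>(i, j, k) x. if x \<in> S2 then x$1 ^ i * x$2 ^ j * x$3 ^ k else 0)"

definition basis_indices :: "nat \<Rightarrow> (nat \<times> nat \<times> nat) set" where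
  "basis_indices n = {(i, j, k). i + j + k \<le> n \<and> k \<le> 1}"

lemma finite_basis_indices [simp]: "finite (basis_indices n)"
  by (rule finite_subset[OF _ finite_multi_indices[of n]]) (auto simp: basis_indices_def)

lemma subspace_sph_poly: "fs.subspace (sph_poly n)"
proof (rule fs.subspaceI)
  show "0 \<in> sph_poly n"
    using sph_polyI[OF poly3_monom[of 0 0 0 n 0]] by (simp add: func_zero if_distrib cong: if_cong)
qed (auto simp: fun_scale_def func_plus intro: sph_poly_add sph_poly_scale)

text \<open>On the sphere $x_3^2$ can be replaced by $1 - x_1^2 - x_2^2$.\<close>

lemma sph_monom_in_span:
  "i + j + k \<le> n \<Longrightarrow> sph_monom (i, j, k) \<in> fs.span (sph_monom ` basis_indices n)"
proof (induction k arbitrary: i j rule: less_induct)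
  case (less k)
  show ?case
  proof (cases "k \<le> 1")
    case True
    then show ?thesis using less.prems
      by (intro fs.span_base) (auto simp: basis_indices_def)
  next
    case False
    then obtain k' where k: "k = Suc (Suc k')"
      by (metis One_nat_def not_less_eq_eq le0 old.nat.exhaust)
    have "sph_monom (i, j, k) x =
      (sph_monom (i, j, k') - sph_monom (i + 2, j, k') - sph_monom (i, j + 2, k')) x" for x
    proof (cases "x \<in> S2")
      case True
      then have "x \<bullet> x = 1" by (simp add: norm_eq_1)
      then have z: "x$3 * x$3 = 1 - x$1 * x$1 - x$2 * x$2"
        by (simp add: inner_vec_def sum_3)
      have "sph_monom (i, j, k) x = x$1 ^ i * x$2 ^ j * x$3 ^ k' * (x$3 * x$3)"
        using True by (simp add: sph_monom_def k)
      then show ?thesis using True unfolding z by (simp add: sph_monom_def algebra_simps)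
    qed (simp add: sph_monom_def)
    then have "sph_monom (i, j, k) =
      sph_monom (i, j, k') - sph_monom (i + 2, j, k') - sph_monom (i, j + 2, k')"
      by (rule ext)
    then show ?thesis using less.prems
      by (simp only:) (intro fs.span_diff less.IH; simp add: k)
  qed
qed

lemma span_sph_monom: "fs.span (sph_monom ` basis_indices n) = sph_poly n"
proof
  have "sph_monom s \<in> sph_poly n" if "s \<in> basis_indices n" for s
  proof -
    obtain i j k where s: "s = (i, j, k)" by (cases s)
    then have "i + j + k \<le> n" using that by (simp add: basis_indices_def)
    from sph_polyI[OF poly3_monom[OF this, of 1]] show ?thesis
      by (simp add: s sph_monom_def cong: if_cong)
  qed
  then show "fs.span (sph_monom ` basis_indices n) \<subseteq> sph_poly n"
    by (intro fs.span_minimal subspace_sph_poly) auto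
  show "sph_poly n \<subseteq> fs.span (sph_monom ` basis_indices n)"
  proof
    fix p assume "p \<in> sph_poly n"
    then obtain c where p: "p = (\<lambda>x.
      if x \<in> S2 then \<Sum>(i,j,k)\<in>{(i,j,k). i + j + k \<le> n}. c i j k * x$1 ^ i * x$2 ^ j * x$3 ^ k else 0)"
      unfolding sph_poly_def poly3_def by auto
    have "p = (\<Sum>(i,j,k)\<in>{(i,j,k). i + j + k \<le> n}. fun_scale (c i j k) (sph_monom (i, j, k)))"
      by (rule ext) (auto simp: p sum_fun_eval sph_monom_def fun_scale_def case_prod_unfold
        mult.assoc)
    also have "\<dots> \<in> fs.span (sph_monom ` basis_indices n)"
      by (intro fs.span_sum) (auto intro: fs.span_scale sph_monom_in_span)
    finally show "p \<in> fs.span (sph_monom ` basis_indices n)" .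
  qed
qed

section \<open>Linear independence of the reduced monomials and their number\<close>

lemma poly_coeffs_zero:
  fixes a :: "nat \<Rightarrow> real"
  assumes "\<And>x. \<bar>x\<bar> < 1 / 2 \<Longrightarrow> (\<Sum>i\<le>n. a i * x ^ i) = 0" and "i \<le> n"
  shows "a i = 0"
proof (rule ccontr)
  assume "a i \<noteq> 0"
  then have "finite {x. (\<Sum>i\<le>n. a i * x ^ i) = 0}"
    using assms(2) polyfun_finite_roots[of a n] by blast
  then have "finite {- (1/2) <..< 1 / 2 :: real}"
    by (rule rev_finite_subset) (auto intro!: assms)
  then show False by (simp add: infinite_Ioo)
qed

lemma poly2_coeffs_zero:
  fixes a :: "nat \<Rightarrow> nat \<Rightarrow> real"
  assumes "\<And>x y. \<bar>x\<bar> < 1 / 2 \<Longrightarrow> \<bar>y\<bar> < 1 / 2 \<Longrightarrow> (\<Sum>j\<le>n. (\<Sum>i\<le>n. a i j * x ^ i) * y ^ j) = 0"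
    and "i \<le> n" "j \<le> n"
  shows "a i j = 0"
  by (rule poly_coeffs_zero[where n = n and a = "\<lambda>i. a i j"],
     rule poly_coeffs_zero[where n = n and a = "\<lambda>j. \<Sum>i\<le>n. a i j * _ ^ i"])
     (use assms in auto)

text \<open>A combination of reduced monomials has the form A_0(x,y) + z A_1(x,y). The points (x, y,
  z) and (x, y, -z) both lie on the sphere, so A_0 and A_1 vanish wherever z can be chosen nonzero,
  in particular on the square |x|, |y| < 1/2, where 1 - x^2 - y^2 is positive.\<close>

lemma sph_monom_coeffs_zero:
  assumes zero: "\<And>x. x \<in> S2 \<Longrightarrow> (\<Sum>s\<in>basis_indices n. c s * sph_monom s x) = 0"
    and s: "s \<in> basis_indices n"
  shows "c s = 0"
proof -
  \<comment> \<open>Padding with zeros lets all sums run over full boxes instead of the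
    simplex.\<close>
  define a where "a k i j = (if i + j + k \<le> n then c (i, j, k) else 0)" for k i j
  define A where "A k x y = (\<Sum>j\<le>n. (\<Sum>i\<le>n. a k i j * x ^ i) * y ^ j)" for k x y
  have eq: "A 0 x y + z * A 1 x y = 0" if "x\<^sup>2 + y\<^sup>2 + z\<^sup>2 = 1" for x y z
  proof -
    let ?v = "vector [x, y, z] :: real^3"
    have "?v \<bullet> ?v = 1" using that by (simp add: inner_vec_def sum_3 power2_eq_square)
    then have v: "?v \<in> S2" by (simp add: norm_eq_1)
    have "(\<Sum>s\<in>basis_indices n. c s * sph_monom s ?v) =
       (\<Sum>(i,j,k)\<in>basis_indices n. a k i j * x ^ i * y ^ j * z ^ k)"
      using v by (intro sum.cong refl) (auto simp: sph_monom_def a_def basis_indices_def)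
    also have "\<dots> = (\<Sum>(i,j,k)\<in>{..n} \<times> {..n} \<times> {..1}. a k i j * x ^ i * y ^ j * z ^ k)"
      by (intro sum.mono_neutral_left) (auto simp: basis_indices_def a_def split: if_splits)
    also have "\<dots> = (\<Sum>i\<le>n. \<Sum>j\<le>n. \<Sum>k\<le>1. a k i j * x ^ i * y ^ j * z ^ k)"
      by (simp only: sum.cartesian_product [symmetric])
    also have "\<dots> = (\<Sum>j\<le>n. \<Sum>i\<le>n. \<Sum>k\<le>1. a k i j * x ^ i * y ^ j * z ^ k)"
      by (rule sum.swap)
    also have "\<dots> = A 0 x y + z * A 1 x y"
      by (simp add: A_def sum_distrib_left sum_distrib_right sum.distrib mult_ac)
    finally show ?thesis using zero[OF v] by simp
  qed
  have "A 0 x y = 0 \<and> A 1 x y = 0" if "\<bar>x\<bar> < 1 / 2" "\<bar>y\<bar> < 1 / 2" for x y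
  proof -
    have "x\<^sup>2 < (1/2)\<^sup>2" "y\<^sup>2 < (1/2)\<^sup>2"
      using power_strict_mono[OF that(1), of 2] power_strict_mono[OF that(2), of 2] by simp_all
    then have pos: "1 - x\<^sup>2 - y\<^sup>2 > 0" by (simp add: power_divide)
    define z where "z = sqrt (1 - x\<^sup>2 - y\<^sup>2)"
    have "z > 0" "z\<^sup>2 = 1 - x\<^sup>2 - y\<^sup>2" using pos by (auto simp: z_def)
    then have "A 0 x y + z * A 1 x y = 0" "A 0 x y + (- z) * A 1 x y = 0"
      using eq[of x y z] eq[of x y "- z"] by simp_all
    then have "A 0 x y = 0" "z * A 1 x y = 0" by linarith+
    with \<open>z > 0\<close> show ?thesis by auto
  qed
  then have "a k i j = 0" if "i \<le> n" "j \<le> n" "k \<le> 1" for i j k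
    using poly2_coeffs_zero[where n = n and a = "a k" and i = i and j = j] that unfolding A_def
      by (cases "k = 0") (auto simp: le_Suc_eq)
  moreover obtain i j k where ijk: "s = (i, j, k)" by (cases s)
  ultimately have "a k i j = 0" using s by (auto simp: basis_indices_def)
  then show ?thesis using s by (simp add: ijk a_def basis_indices_def)
qed

text \<open>Independence and cardinality concern the image set, so coincidences between monomials
  must be excluded. Equal monomials would satisfy a linear relation with coefficients 1 and
  -1.\<close>

lemma inj_on_sph_monom: "inj_on sph_monom (basis_indices n)"
proof (rule inj_onI, rule ccontr)
  fix s t assume *: "s \<in> basis_indices n" "t \<in> basis_indices n" "sph_monom s = sph_monom t" "s \<noteq> t"
  define c where "c r = of_bool (r = s) - (of_bool (r = t) :: real)" for r
  have sums: "(\<Sum>r\<in>basis_indices n. c r * sph_monom r x) = sph_monom s x - sph_monom t x" for x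
  proof -
    have "(\<Sum>r\<in>basis_indices n. c r * sph_monom r x) =
      (\<Sum>r\<in>basis_indices n. if r = s then sph_monom s x else 0) -
      (\<Sum>r\<in>basis_indices n. if r = t then sph_monom t x else 0)"
      unfolding sum_subtractf [symmetric] by (intro sum.cong refl) (simp add: c_def)
    then show ?thesis using *(1,2) by simp
  qed
  have "c s = 0"
    by (rule sph_monom_coeffs_zero[OF _ *(1)]) (simp only: sums *(3) diff_self)
  with \<open>s \<noteq> t\<close> show False by (simp add: c_def)
qed

text \<open>The layers k = 0 and k = 1 are triangular arrays with sides n + 1 and n; two consecutive
  triangular numbers add up to a square.\<close>

lemma card_basis_indices: "card (basis_indices n) = (n + 1)\<^sup>2"
proof -
  have tri: "card {(i, j). i + j < m} = (\<Sum>i<m. m - i)" for m :: nat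
  proof -
    have "{(i, j). i + j < m} = (SIGMA i:{..<m}. {..<m - i})" by auto
    then show ?thesis by simp
  qed
  have gauss: "2 * (\<Sum>i<m. m - i) = m * (m + 1)" for m :: nat
    by (induction m) (simp_all add: sum.lessThan_Suc_shift del: sum.lessThan_Suc)
  have fin: "finite {(i, j). i + j < m}" for m :: nat
    by (rule finite_subset[of _ "{..m} \<times> {..m}"]) auto
  have "basis_indices n = (\<lambda>(i, j). (i, j, 0)) ` {(i, j). i +
    j < Suc n} \<union> (\<lambda>(i, j). (i, j, 1)) ` {(i, j). i + j < n}"
    by (auto simp: basis_indices_def image_iff le_Suc_eq)
  moreover have "card (\<dots>) = card {(i, j). i + j < Suc n} + card {(i, j). i + j < n}"
    by (subst card_Un_disjoint) (use fin[of n] fin[of "Suc n"] in \<open>auto simp: card_image inj_on_def\<close>)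
  ultimately have "2 * card (basis_indices n) = Suc n * (Suc n + 1) + n * (n + 1)"
    using gauss[of n] gauss[of "Suc n"] by (simp only: tri distrib_left)
  then show ?thesis by (simp add: power2_eq_square)
qed

theorem sph_dim_eq: "sph_dim n = (n + 1)\<^sup>2"
proof -
  have "fs.span (sph_monom ` basis_indices n) = fs.span (sph_poly n)"
    by (simp only: span_sph_monom[symmetric] fs.span_span)
  moreover have "fs.independent (sph_monom ` basis_indices n)"
  proof
    assume "fs.dependent (sph_monom ` basis_indices n)"
    then obtain u v where u: "v \<in> basis_indices n" "u (sph_monom v) \<noteq> 0"
      "(\<Sum>f\<in>sph_monom ` basis_indices n. fun_scale (u f) f) = 0"
      by (subst (asm) fs.dependent_finite) auto
    have "(\<Sum>s\<in>basis_indices n. fun_scale (u (sph_monom s)) (sph_monom s)) = 0"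
      using u(3) by (simp add: sum.reindex[OF inj_on_sph_monom])
    then have "(\<Sum>s\<in>basis_indices n. u (sph_monom s) * sph_monom s x) = 0" for x
      by (simp add: fun_eq_iff sum_fun_eval fun_scale_def)
    from sph_monom_coeffs_zero[OF this u(1)] u(2) show False by simp
  qed
  ultimately have "fs.dim (sph_poly n) = card (sph_monom ` basis_indices n)"
    by (rule fs.dim_eq_card)
  then show ?thesis
    by (simp add: sph_dim_def card_image[OF inj_on_sph_monom] card_basis_indices)
qed

section \<open>Best approximation\<close>

text \<open>Adjoining one vector $b$ to a spanning set reduces the minimization to the line
  $c \mapsto f - c b$ and the seminorm distance from the span of the others; no compactness beyond
  that of real intervals is needed.\<close>

lemma seminorm_best_approximation:
  fixes scale :: "real \<Rightarrow> 'b::ab_group_add \<Rightarrow> 'b" and N :: "'b \<Rightarrow> real"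
  assumes "vector_space scale" and E: "module.subspace scale E"
    and tri: "\<And>f g. f \<in> E \<Longrightarrow> g \<in> E \<Longrightarrow> N (f + g) \<le> N f + N g"
    and hom: "\<And>c f. f \<in> E \<Longrightarrow> N (scale c f) = \<bar>c\<bar> * N f"
    and B: "finite B" "B \<subseteq> E" and f: "f \<in> E"
  shows "\<exists>p\<in>module.span scale B. \<forall>q\<in>module.span scale B. N (f - p) \<le> N (f - q)"
proof -
  interpret vector_space scale by fact
  show ?thesis using B f
  proof (induction B arbitrary: f rule: finite_induct)
    case empty
    then show ?case by simp
  next
    case (insert b B)
    \<comment> \<open>\<open>P f\<close> is a chosen best approximation from the smaller span and
      \<open>D f\<close> its error. \<open>D\<close> inherits from \<open>N\<close> the seminorm
      inequalities used below.\<close>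
    define P where "P f = (SOME p. p \<in> span B \<and> (\<forall>q\<in>span B. N (f - p) \<le> N (f - q)))" for f
    define D where "D f = N (f - P f)" for f
    have spanE: "p \<in> E" if "p \<in> span B" for p
      using span_minimal[OF _ E] insert.prems that by auto
    have bE: "b \<in> E" using insert.prems by simp
    have P: "P f \<in> span B" "q \<in> span B \<Longrightarrow> D f \<le> N (f - q)" if "f \<in> E" for f q
    proof -
      have "\<exists>p. p \<in> span B \<and> (\<forall>q\<in>span B. N (f - p) \<le> N (f - q))"
        using insert.IH[OF _ that] insert.prems by auto
      from someI_ex[OF this] show "P f \<in> span B" "q \<in> span B \<Longrightarrow> D f \<le> N (f - q)"
        by (auto simp: P_def D_def)
    qed
    have PE: "P f \<in> E" if "f \<in> E" for f
      using P(1)[OF that] by (rule spanE)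
    have D_tri: "D (f + g) \<le> D f + D g" if "f \<in> E" "g \<in> E" for f g
    proof -
      have "D (f + g) \<le> N ((f + g) - (P f + P g))"
        using that by (intro P subspace_add E span_add)
      also have "(f + g) - (P f + P g) = (f - P f) + (g - P g)" by simp
      also have "N \<dots> \<le> D f + D g" unfolding D_def
        using that by (intro tri subspace_diff E PE)
      finally show ?thesis .
    qed
    have D_hom: "D (scale c f) \<le> \<bar>c\<bar> * D f" if "f \<in> E" for c f
    proof -
      have "D (scale c f) \<le> N (scale c f - scale c (P f))"
        using that by (intro P subspace_scale E span_scale)
      also have "\<dots> = N (scale c (f - P f))" by (simp add: scale_right_diff_distrib)
      also have "\<dots> = \<bar>c\<bar> * D f" unfolding D_def using that by (intro hom subspace_diff E PE)
      finally show ?thesis .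
    qed
    have N0: "N g \<ge> 0" if "g \<in> E" for g
    proof -
      have "N (g + scale (-1) g) \<le> N g + N (scale (-1) g)" using that by (intro tri subspace_scale E)
      moreover have "N 0 = 0" using hom[of g 0] that by simp
      ultimately show ?thesis using hom[OF that, of "-1"] by simp
    qed
    have D0: "D g \<ge> 0" if "g \<in> E" for g
      unfolding D_def using that by (intro N0 subspace_diff E PE)
    define h where "h c = D (f - scale c b)" for c
    have arg: "f - scale c b \<in> E" for c
      using insert.prems bE by (intro subspace_diff subspace_scale E) auto
    have lip: "h c \<le> h d + \<bar>c - d\<bar> * D b" for c d
    proof -
      have "f - scale c b = (f - scale d b) + scale (d - c) b" by (simp add: scale_left_diff_distrib)
      then have "h c \<le> h d + D (scale (d - c) b)"
        using D_tri[OF arg[of d] subspace_scale[OF E bE, of "d - c"]] by (simp only: h_def)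
      also have "\<dots> \<le> h d + \<bar>c - d\<bar> * D b" using D_hom[OF bE, of "d - c"]
        by (simp add: abs_minus_commute)
      finally show ?thesis .
    qed
    have "\<exists>c0. \<forall>c. h c0 \<le> h c"
    \<comment> \<open>If b has distance 0 from the smaller span, \<open>lip\<close> makes
      \<open>h\<close> constant.\<close>
    proof (cases "D b = 0")
      case True
      then have "h 0 \<le> h c" for c using lip[of 0 c] by simp
      then show ?thesis by blast
    next
      case False
      then have Db: "D b > 0" using D0[OF bE] by simp
      \<comment> \<open>For |c| \<ge> R one has h c \<ge> |c| D b - D f \<ge> D f = h 0, so a
        minimum over [-R, R], which contains 0, is global.\<close>
      define R where "R = 2 * D f / D b"
      have "R \<ge> 0" using D0 insert.prems Db by (simp add: R_def)
      have "\<bar>h c - h d\<bar> \<le> D b * \<bar>c - d\<bar>" for c d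
        using lip[of c d] lip[of d c] by (simp add: abs_le_iff abs_minus_commute mult.commute)
      then have "(D b)-lipschitz_on {-R..R} h"
        using Db by (intro lipschitz_onI) (auto simp: dist_real_def)
      then have "continuous_on {-R..R} h" by (rule lipschitz_on_continuous_on)
      then have "\<exists>c0\<in>{-R..R}. \<forall>c\<in>{-R..R}. h c0 \<le> h c"
        using \<open>R \<ge> 0\<close> by (intro continuous_attains_inf) auto
      then obtain c0 where c0: "\<And>c. c \<in> {-R..R} \<Longrightarrow> h c0 \<le> h c" by blast
      have "h c0 \<le> h c" if "c \<notin> {-R..R}" for c
      proof -
        have c: "\<bar>c\<bar> \<ge> R" "c \<noteq> 0" using that \<open>R \<ge> 0\<close> by auto
        \<comment> \<open>\<open>D_hom\<close> is only an upper bound; applied to the inverse factor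
          it yields the lower bound.\<close>
        have "D b \<le> D (scale (inverse c) (scale c b))" using c by simp
        also have "\<dots> \<le> \<bar>inverse c\<bar> * D (scale c b)"
          by (intro D_hom subspace_scale E bE)
        finally have "\<bar>c\<bar> * D b \<le> D (scale c b)" using c by (simp add: field_simps)
        also have "scale c b = f + scale (- 1) (f - scale c b)" by simp
        also have "D \<dots> \<le> D f + h c"
          using D_tri[OF _ subspace_scale[OF E arg[of c]], of f "-1"] D_hom[OF arg[of c], of "-1"]
            insert.prems
          by (simp add: h_def)
        finally have "\<bar>c\<bar> * D b \<le> D f + h c" .
        moreover have "2 * D f \<le> \<bar>c\<bar> * D b" using c(1) Db by (simp add: R_def field_simps)
        moreover have "h c0 \<le> D f" using c0[of 0] \<open>R \<ge> 0\<close> by (simp add: h_def)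
        ultimately show ?thesis by simp
      qed
      with c0 show ?thesis by blast
    qed
    then obtain c0 where c0: "\<And>c. h c0 \<le> h c" by blast
    define p where "p = scale c0 b + P (f - scale c0 b)"
    have "p \<in> span (insert b B)"
      unfolding span_breakdown_eq by (rule exI[of _ c0]) (simp add: p_def P(1)[OF arg])
    moreover have "N (f - p) \<le> N (f - q)" if q: "q \<in> span (insert b B)" for q
    proof -
      obtain k where k: "q - scale k b \<in> span B" using q by (auto simp: span_breakdown_eq)
      have "N (f - p) = h c0" by (simp add: p_def h_def D_def algebra_simps)
      also have "\<dots> \<le> h k" by (rule c0)
      also have "\<dots> \<le> N (f - scale k b - (q - scale k b))" unfolding h_def by (rule P(2)[OF arg k])
      finally show ?thesis by simp
    qed
    ultimately show ?case by blast
  qed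
qed

lemma is_wls_exists:
  assumes T: "finite T" "\<And>t. t \<in> T \<Longrightarrow> w t \<ge> 0"
  shows "\<exists>p. is_wls n T w f p"
proof -
  define N where "N g = L2_set (\<lambda>t. sqrt (w t) * g t) T" for g :: "real^3 \<Rightarrow> real"
  have N2: "N g = sqrt (\<Sum>t\<in>T. w t * (g t)\<^sup>2)" for g
    using T by (auto simp: N_def L2_set_def power_mult_distrib intro!: sum.cong)
  have "\<exists>p\<in>fs.span (sph_monom ` basis_indices n). \<forall>q\<in>fs.span (sph_monom ` basis_indices n). N (f -
    p) \<le> N (f - q)"
  proof (rule seminorm_best_approximation[OF vector_space_fun_scale, of UNIV])
    show "N (g + h) \<le> N g + N h" for g h
      using L2_set_triangle_ineq[of "\<lambda>t. sqrt (w t) * g t" "\<lambda>t. sqrt (w t) * h t" T]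
      by (simp add: N_def distrib_left)
    show "N (fun_scale c g) = \<bar>c\<bar> * N g" for c g
    proof -
      have "(\<Sum>t\<in>T. w t * (fun_scale c g t)\<^sup>2) = c\<^sup>2 * (\<Sum>t\<in>T. w t * (g t)\<^sup>2)"
        by (simp add: fun_scale_def power_mult_distrib sum_distrib_left mult_ac)
      then show ?thesis by (simp add: N2 real_sqrt_mult)
    qed
  qed auto
  then show ?thesis
    unfolding is_wls_def is_arg_min_def span_sph_monom N2
    by (auto simp: not_less)
qed

lemma is_wls_pythagoras:
  assumes p: "is_wls n T w f p" and q: "q \<in> sph_poly n"
  shows "(\<Sum>t\<in>T. w t * (f t - q t)\<^sup>2) = (\<Sum>t\<in>T. w t * (f t - p t)\<^sup>2) + (\<Sum>t\<in>T. w t * (p t - q t)\<^sup>2)"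
proof -
  define I where "I = (\<Sum>t\<in>T. w t * ((f t - p t) * (p t - q t)))"
  define J where "J = (\<Sum>t\<in>T. w t * (p t - q t)\<^sup>2)"
  have expand: "(\<Sum>t\<in>T. w t * (f t - (p t - c * (p t - q t)))\<^sup>2) =
    (\<Sum>t\<in>T. w t * (f t - p t)\<^sup>2) + 2 * c * I + c\<^sup>2 * J" for c
    unfolding I_def J_def sum_distrib_left sum.distrib[symmetric]
    by (intro sum.cong refl) (simp add: power2_eq_square algebra_simps)
  have pn: "p \<in> sph_poly n" using p by (simp add: is_wls_def is_arg_min_def)
  have ge: "0 \<le> 2 * c * I + c\<^sup>2 * J" for c
  proof -
    have "(\<lambda>x. p x - c * (p x - q x)) \<in> sph_poly n"
      by (intro sph_poly_diff sph_poly_scale pn q)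
    then have "(\<Sum>t\<in>T. w t * (f t - p t)\<^sup>2) \<le> (\<Sum>t\<in>T. w t * (f t - (p t - c * (p t - q t)))\<^sup>2)"
      using p by (force simp: is_wls_def is_arg_min_def not_less)
    then show ?thesis by (simp add: expand)
  qed
  have "I = 0"
  proof (rule ccontr)
    assume "I \<noteq> 0"
    \<comment> \<open>With d positive and at least J, the choice c = -I/d makes the quadratic at
      most -2 I^2/d + I^2/d = -I^2/d, which is negative.\<close>
    define d where "d = \<bar>J\<bar> + 1"
    have "d > 0" by (simp add: d_def)
    have "0 \<le> 2 * (- (I / d)) * I + (- (I / d))\<^sup>2 * J" by (rule ge)
    also have "\<dots> \<le> 2 * (- (I / d)) * I + (- (I / d))\<^sup>2 * d"
      by (intro add_left_mono mult_left_mono) (auto simp: d_def)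
    also have "\<dots> = - (I\<^sup>2 / d)" using \<open>d > 0\<close> by (simp add: power2_eq_square field_simps)
    also have "\<dots> < 0" using \<open>I \<noteq> 0\<close> \<open>d > 0\<close> by simp
    finally show False by simp
  qed
  with expand[of 1] show ?thesis by (simp add: J_def)
qed

lemma is_best_approx_exists:
  assumes f: "continuous_on S2 f"
  shows "\<exists>q. is_best_approx n f q"
proof -
  \<comment> \<open>The seminorm laws of \<open>sup_norm\<close> are guaranteed only where the
    suprema are finite, so the ambient space consists of the functions bounded on the
    sphere.\<close>
  let ?E = "{g :: real^3 \<Rightarrow> real. \<exists>B. \<forall>x\<in>S2. \<bar>g x\<bar> \<le> B}"
  have bdd: "g \<in> ?E" if "continuous_on S2 g" for g
  proof -
    obtain x where "x \<in> S2" "sup_norm S2 g = \<bar>g x\<bar>" "\<And>y. y \<in> S2 \<Longrightarrow> \<bar>g y\<bar> \<le> \<bar>g x\<bar>"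
      by (rule sup_norm_attained_S2[OF \<open>continuous_on S2 g\<close>]) (rule that)
    then show ?thesis by (intro CollectI exI[of _ "\<bar>g x\<bar>"]) simp
  qed
  have upper: "\<bar>g x\<bar> \<le> sup_norm S2 g" if gx: "g \<in> ?E" "x \<in> S2" for g x
  proof -
    obtain B where "\<forall>x\<in>S2. \<bar>g x\<bar> \<le> B" using gx(1) by blast
    then show ?thesis using gx(2) by (intro sup_norm_upper[of S2 g B]) auto
  qed
  have ne: "S2 \<noteq> {}" by simp
  have scaleE: "fun_scale c g \<in> ?E" if g: "g \<in> ?E" for c g
  proof -
    obtain B where "\<forall>x\<in>S2. \<bar>g x\<bar> \<le> B" using g by blast
    then show ?thesis
      by (intro CollectI exI[of _ "\<bar>c\<bar> * B"]) (simp add: fun_scale_def abs_mult mult_left_mono)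
  qed
  have "\<exists>p\<in>fs.span (sph_monom ` basis_indices n). \<forall>q\<in>fs.span (sph_monom ` basis_indices n).
     sup_norm S2 (f - p) \<le> sup_norm S2 (f - q)"
  proof (rule seminorm_best_approximation[OF vector_space_fun_scale, of ?E])
    show "fs.subspace ?E"
    proof (rule fs.subspaceI)
      fix g h assume "g \<in> ?E" "h \<in> ?E"
      then obtain B C where "\<forall>x\<in>S2. \<bar>g x\<bar> \<le> B" "\<forall>x\<in>S2. \<bar>h x\<bar> \<le> C" by blast
      then have "\<forall>x\<in>S2. \<bar>(g + h) x\<bar> \<le> B + C"
        by (force intro: order_trans[OF abs_triangle_ineq] add_mono)
      then show "g + h \<in> ?E" by blast
    qed (use scaleE in auto)
    show "sup_norm S2 (g + h) \<le> sup_norm S2 g + sup_norm S2 h" if "g \<in> ?E" "h \<in> ?E" for g h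
    proof (rule sup_norm_least[OF ne])
      fix x assume "x \<in> S2"
      then have "\<bar>g x\<bar> \<le> sup_norm S2 g" "\<bar>h x\<bar> \<le> sup_norm S2 h"
        using upper that by simp_all
      then show "\<bar>(g + h) x\<bar> \<le> sup_norm S2 g + sup_norm S2 h" by simp
    qed
    have le: "sup_norm S2 (fun_scale c g) \<le> \<bar>c\<bar> * sup_norm S2 g" if "g \<in> ?E" for c g
    proof (rule sup_norm_least[OF ne])
      fix x assume "x \<in> S2"
      then have "\<bar>g x\<bar> \<le> sup_norm S2 g" using upper that by simp
      then show "\<bar>fun_scale c g x\<bar> \<le> \<bar>c\<bar> * sup_norm S2 g"
        by (simp add: fun_scale_def abs_mult mult_left_mono)
    qed
    show "sup_norm S2 (fun_scale c g) = \<bar>c\<bar> * sup_norm S2 g" if g: "g \<in> ?E" for c g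
    proof (cases "c = 0")
      case True
      have "sup_norm S2 (fun_scale 0 g) = 0"
        by (simp add: sup_norm_def fun_scale_def)
      with True show ?thesis by simp
    next
      case False
      then have "g = fun_scale (inverse c) (fun_scale c g)" by (simp add: fun_scale_def fun_eq_iff)
      then have "sup_norm S2 g \<le> \<bar>inverse c\<bar> * sup_norm S2 (fun_scale c g)"
        using le[OF scaleE[OF g, of c], of "inverse c"] by simp
      then have "\<bar>c\<bar> * sup_norm S2 g \<le> sup_norm S2 (fun_scale c g)"
        using False by (simp add: field_simps)
      with le[OF g, of c] show ?thesis by simp
    qed
    show "sph_monom ` basis_indices n \<subseteq> ?E"
    proof -
      have "sph_monom ` basis_indices n \<subseteq> sph_poly n"
        unfolding span_sph_monom[symmetric] by (rule fs.span_superset)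
      then show ?thesis using bdd[OF continuous_on_sph_poly] by - (rule subset_trans, auto)
    qed
    show "f \<in> ?E" by (rule bdd) (fact f)
  qed auto
  then show ?thesis
    unfolding is_best_approx_def is_arg_min_def span_sph_monom
    by (simp add: not_less fun_diff_def) blast
qed

section \<open>Caratheodory--Tchakaloff submeshes\<close>

context
  fixes n :: nat and Y T :: "(real^3) set" and w :: "real^3 \<Rightarrow> real"
  assumes ct: "ct_submesh n Y T w"
    and Y: "finite Y" "Y \<noteq> {}" "Y \<subseteq> S2"
begin

text \<open>Exactness for the constant 1. It also forces T to be nonempty when Y is.\<close>

lemma ct_submesh_sum_weights: "(\<Sum>t\<in>T. w t) = card Y"
proof -
  have "(\<lambda>x. 1 * x$1 ^ 0 * x$2 ^ 0 * x$3 ^ 0) \<in> poly3 (2 * n)" by (rule poly3_monom) simp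
  then show ?thesis using ct unfolding ct_submesh_def by force
qed

lemma ct_submesh_nodes: "finite T" "T \<subseteq> S2" "T \<noteq> {}" "t \<in> T \<Longrightarrow> w t > 0"
  using ct Y ct_submesh_sum_weights by (auto simp: ct_submesh_def)

lemma ct_submesh_square_sum:
  assumes "p \<in> sph_poly n"
  shows "(\<Sum>y\<in>Y. (p y)\<^sup>2) = (\<Sum>t\<in>T. w t * (p t)\<^sup>2)"
proof -
  obtain P where P: "P \<in> poly3 n" "\<And>x. x \<in> S2 \<Longrightarrow> p x = P x" using assms by (elim sph_polyE) blast
  have "(\<lambda>x. P x * P x) \<in> poly3 (2 * n)" using poly3_mult[OF P(1) P(1)] by (simp add: mult_2)
  then have "(\<Sum>y\<in>Y. P y * P y) = (\<Sum>t\<in>T. w t * (P t * P t))"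
    using ct by (simp add: ct_submesh_def)
  moreover have "(\<Sum>y\<in>Y. (p y)\<^sup>2) = (\<Sum>y\<in>Y. P y * P y)"
    using P Y by (intro sum.cong) (auto simp: power2_eq_square)
  moreover have "(\<Sum>t\<in>T. w t * (p t)\<^sup>2) = (\<Sum>t\<in>T. w t * (P t * P t))"
    using P ct_submesh_nodes by (intro sum.cong) (auto simp: power2_eq_square)
  ultimately show ?thesis by simp
qed

lemma ct_submesh_weighted_bound:
  assumes "\<And>t. t \<in> T \<Longrightarrow> \<bar>g t\<bar> \<le> \<beta>"
  shows "(\<Sum>t\<in>T. w t * (g t)\<^sup>2) \<le> real (card Y) * \<beta>\<^sup>2"
proof -
  have "(\<Sum>t\<in>T. w t * (g t)\<^sup>2) \<le> (\<Sum>t\<in>T. w t * \<beta>\<^sup>2)"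
    using power_mono[OF assms abs_ge_zero, of _ 2] ct_submesh_nodes(4)
    by (intro sum_mono mult_left_mono) (auto intro: less_imp_le)
  then show ?thesis by (simp add: sum_distrib_right[symmetric] ct_submesh_sum_weights)
qed

text \<open>\<kappa> is the reciprocal of a mesh constant of Y, and C any bound for sqrt(card
  Y)/\<kappa>; keeping C free postpones the rounding of cardinalities to the concrete
  constants.\<close>

context
  fixes \<kappa> C :: real
  assumes mesh: "\<And>p. p \<in> sph_poly n \<Longrightarrow> sup_norm S2 p * \<kappa> \<le> sup_norm Y p"
    and \<kappa>: "\<kappa> > 0" "sqrt (card Y) \<le> \<kappa> * C"
begin

text \<open>Each value of p on Y is bounded by its l2 norm there, which exactness turns into the
  weighted norm on T. The parameter \<beta> covers three uses: the maximum of |p| on T for the mesh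
  property, 0 for uniqueness, and the uniform error of a competitor for the projection.\<close>

lemma ct_submesh_sup_norm:
  assumes p: "p \<in> sph_poly n" and le: "(\<Sum>t\<in>T. w t * (p t)\<^sup>2) \<le> real (card Y) * \<beta>\<^sup>2" and \<beta>: "\<beta> \<ge> 0"
  shows "sup_norm S2 p \<le> C * \<beta>"
proof -
  have "sup_norm S2 p * \<kappa> \<le> sup_norm Y p" by (rule mesh) (fact p)
  also have "\<dots> \<le> sqrt (card Y) * \<beta>"
  proof (rule sup_norm_least[OF Y(2)])
    fix y assume "y \<in> Y"
    then have "(p y)\<^sup>2 \<le> (\<Sum>y\<in>Y. (p y)\<^sup>2)" using Y by (intro member_le_sum) auto
    also have "\<dots> \<le> real (card Y) * \<beta>\<^sup>2" using le by (simp add: ct_submesh_square_sum p)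
    finally have "sqrt ((p y)\<^sup>2) \<le> sqrt (real (card Y) * \<beta>\<^sup>2)" by (rule real_sqrt_le_mono)
    then show "\<bar>p y\<bar> \<le> sqrt (card Y) * \<beta>" using \<beta> by (simp add: real_sqrt_mult)
  qed
  also have "\<dots> \<le> \<kappa> * C * \<beta>" using \<kappa> \<beta> by (intro mult_right_mono) auto
  finally have "\<kappa> * sup_norm S2 p \<le> \<kappa> * (C * \<beta>)" by (simp add: mult_ac)
  then show ?thesis using \<kappa> by simp
qed

lemma ct_submesh_mesh: "p \<in> sph_poly n \<Longrightarrow> sup_norm S2 p \<le> C * sup_norm T p"
  using ct_submesh_nodes(3) sup_norm_upper_finite[OF ct_submesh_nodes(1)]
  by (intro ct_submesh_sup_norm ct_submesh_weighted_bound) (auto intro: order_trans[OF abs_ge_zero])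

text \<open>By \<open>is_wls_pythagoras\<close> two minimizers have weighted distance 0, so the case
  \<beta> = 0 makes them agree on the sphere. Off the sphere both are 0 by the extension
  convention.\<close>

lemma ct_submesh_is_wls_unique: "\<exists>!p. is_wls n T w f p"
proof -
  obtain p where p: "is_wls n T w f p"
    using is_wls_exists[OF ct_submesh_nodes(1), of w n f] ct_submesh_nodes(4)
      by (auto intro: less_imp_le)
  moreover have "q = p" if q: "is_wls n T w f q" for q
  proof -
    have pq: "p \<in> sph_poly n" "q \<in> sph_poly n" using p q by (auto simp: is_wls_def is_arg_min_def)
    then have d: "(\<lambda>x. p x - q x) \<in> sph_poly n" by (rule sph_poly_diff)
    have "(\<Sum>t\<in>T. w t * (f t - q t)\<^sup>2) \<le> (\<Sum>t\<in>T. w t * (f t - p t)\<^sup>2)"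
      using p q by (auto simp: is_wls_def is_arg_min_def not_less)
    then have "sup_norm S2 (\<lambda>x. p x - q x) \<le> C * 0"
      using is_wls_pythagoras[OF p pq(2)] by (intro ct_submesh_sup_norm d) auto
    moreover have "\<bar>p x - q x\<bar> \<le> sup_norm S2 (\<lambda>x. p x - q x)" if "x \<in> S2" for x
      using sup_norm_attained_S2[OF continuous_on_sph_poly[OF d]] that by metis
    ultimately have "q x = p x" if "x \<in> S2" for x using that by force
    moreover have "q x = p x" if "x \<notin> S2" for x
      using pq that by (elim sph_polyE) simp
    ultimately show ?thesis by blast
  qed
  ultimately show ?thesis by blast
qed

text \<open>Splitting f - p into f - q and q - p leaves the polynomial p - q, whose weighted norm is
  at most that of f - q by \<open>is_wls_pythagoras\<close>. This holds for every q, in particular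
  for a best approximation.\<close>

lemma ct_submesh_wls_error:
  assumes f: "continuous_on S2 f" and q: "q \<in> sph_poly n"
  shows "sup_norm S2 (\<lambda>x. f x - wls n T w f x) \<le> (1 + C) * sup_norm S2 (\<lambda>x. f x - q x)"
proof -
  define p where "p = wls n T w f"
  have p: "is_wls n T w f p"
    unfolding p_def wls_def by (rule theI'[OF ct_submesh_is_wls_unique])
  then have "p \<in> sph_poly n" by (simp add: is_wls_def is_arg_min_def)
  then have d: "(\<lambda>x. p x - q x) \<in> sph_poly n" using q by (rule sph_poly_diff)
  define \<beta> where "\<beta> = sup_norm S2 (\<lambda>x. f x - q x)"
  have "continuous_on S2 (\<lambda>x. f x - q x)" by (intro continuous_on_diff f continuous_on_sph_poly[OF q])
  then obtain x0 where x0: "\<beta> = \<bar>f x0 - q x0\<bar>" and "\<And>x. x \<in> S2 \<Longrightarrow> \<bar>f x - q x\<bar> \<le> \<bar>f x0 - q x0\<bar>"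
    unfolding \<beta>_def using sup_norm_attained_S2[of "\<lambda>x. f x - q x"] by blast
  then have \<beta>: "\<bar>f x - q x\<bar> \<le> \<beta>" if "x \<in> S2" for x using that by simp
  have "(\<Sum>t\<in>T. w t * (p t - q t)\<^sup>2) \<le> (\<Sum>t\<in>T. w t * (f t - q t)\<^sup>2)"
    unfolding is_wls_pythagoras[OF p q] using ct_submesh_nodes(4)
      by (simp add: sum_nonneg less_imp_le)
  also have "\<dots> \<le> real (card Y) * \<beta>\<^sup>2"
    using \<beta> ct_submesh_nodes(2) by (intro ct_submesh_weighted_bound) auto
  finally have *: "sup_norm S2 (\<lambda>x. p x - q x) \<le> C * \<beta>"
    using x0 by (intro ct_submesh_sup_norm d) auto
  show ?thesis unfolding p_def[symmetric] \<beta>_def[symmetric]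
  proof (rule sup_norm_least)
    fix x assume x: "x \<in> S2"
    have "\<bar>p x - q x\<bar> \<le> sup_norm S2 (\<lambda>x. p x - q x)"
      using sup_norm_attained_S2[OF continuous_on_sph_poly[OF d]] x by metis
    with * \<beta>[OF x] show "\<bar>f x - p x\<bar> \<le> (1 + C) * \<beta>" by (simp add: distrib_right)
  qed simp
qed

end

end

text \<open>Two points leave a point at distance $\sqrt 2$ from both uncovered.\<close>

lemma good_covering_const_ge_2:
  assumes "good_covering X \<alpha>"
  shows "\<alpha> \<ge> 2"
proof -
  have X: "finite (X 2)" "X 2 \<subseteq> S2" "card (X 2) = 2" "covering_radius (X 2) \<le> \<alpha> / sqrt 2"
    using assms unfolding good_covering_def by force+
  \<comment> \<open>Two points span at most a plane, so some unit vector is orthogonal to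
    both.\<close>
  have "dim (X 2) < DIM(real^3)"
    using dim_le_card[of "X 2" "X 2"] X span_superset[of "X 2"] by simp
  then obtain z where z: "z \<noteq> 0" "\<And>y. y \<in> span (X 2) \<Longrightarrow> orthogonal z y"
    using orthogonal_to_subspace_exists by metis
  define u where "u = z /\<^sub>R norm z"
  have u: "u \<in> S2" using z by (simp add: u_def)
  have "X 2 \<noteq> {}" using X(3) by auto
  then obtain y where y: "y \<in> X 2" "dist u y \<le> covering_radius (X 2)"
    using covering_radius_point[OF X(1) _ X(2) u] by blast
  have "norm u = 1" "norm y = 1" using u y X by auto
  then have "u \<bullet> u = 1" "y \<bullet> y = 1" by (simp_all add: norm_eq_1)
  moreover have "u \<bullet> y = 0"
    using z(2)[OF span_base[OF y(1)]] by (simp add: u_def orthogonal_def)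
  ultimately have "(dist u y)\<^sup>2 = 2"
    by (simp add: dist_norm power2_norm_eq_inner inner_diff inner_commute)
  then have "dist u y = sqrt 2" by (metis real_sqrt_abs abs_of_nonneg zero_le_dist)
  with y(2) X(4) have "sqrt 2 \<le> \<alpha> / sqrt 2" by simp
  then have "sqrt 2 * sqrt 2 \<le> \<alpha>" by (simp add: le_divide_eq)
  then show ?thesis by simp
qed

text \<open>Common to the general and the zonal case. Here \<theta>/n is the radius that the
  covering actually guarantees, D the mesh constant of the covering and C n the constant of its
  submesh. The linear bound K n on C n gives both the cardinality O(n^2) and subexponential
  growth.\<close>

lemma covering_ct_mesh:
  fixes X T :: "nat \<Rightarrow> (real^3) set" and M :: "nat \<Rightarrow> nat" and C :: "nat \<Rightarrow> real"
  assumes cov: "good_covering X \<alpha>"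
    and ct: "\<And>n. n \<ge> 1 \<Longrightarrow> ct_submesh n (X (M n)) (T n) (w n)"
    and \<theta>: "0 < \<theta>" "\<theta> \<le> 1"
    and M2: "\<And>n. n \<ge> 1 \<Longrightarrow> M n \<ge> 2"
    and radius: "\<And>n. n \<ge> 1 \<Longrightarrow> \<alpha> * real n \<le> \<theta> * sqrt (M n)"
    and D: "1 \<le> (1 - 18 / 25 * \<theta>\<^sup>2) * D"
    and C: "\<And>n. n \<ge> 1 \<Longrightarrow> sqrt (M n) \<le> (1 - 18 / 25 * \<theta>\<^sup>2) * C n"
    and K: "\<And>n. n \<ge> 1 \<Longrightarrow> C n \<le> K * real n"
  shows "optimal_mesh (\<lambda>n. X (M n)) D"
    and "weakly_admissible_mesh T C"
    and "\<forall>n\<ge>1. \<forall>f. continuous_on S2 f \<longrightarrow>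
           (\<exists>!p. is_wls n (T n) (w n) f p) \<and>
           (\<exists>q. is_best_approx n f q \<and>
              sup_norm S2 (\<lambda>x. f x - wls n (T n) (w n) f x) \<le>
                (1 + C n) * sup_norm S2 (\<lambda>x. f x - q x))"
proof -
  define \<kappa> where "\<kappa> = 1 - 18 / 25 * \<theta>\<^sup>2"
  have "\<theta>\<^sup>2 \<le> 1" using \<theta> by (simp add: power_le_one)
  then have \<kappa>: "\<kappa> > 0" "\<kappa> \<le> 1" by (simp_all add: \<kappa>_def)
  have X: "finite (X (M n))" "X (M n) \<noteq> {}" "X (M n) \<subseteq> S2" "card (X (M n)) = M n"
    "covering_radius (X (M n)) \<le> \<theta> / real n" if n: "n \<ge> 1" for n
  proof -
    have *: "finite (X (M n)) \<and> X (M n) \<subseteq> S2 \<and> card (X (M n)) = M n \<and> covering_radius (X (M n)) \<le>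
      \<alpha> / sqrt (M n)"
      using cov M2[OF n] unfolding good_covering_def by blast
    then show "finite (X (M n))" "X (M n) \<subseteq> S2" "card (X (M n)) = M n" by auto
    then show "X (M n) \<noteq> {}" using M2[OF n] by auto
    have "\<alpha> / sqrt (M n) \<le> \<theta> / real n" using radius[OF n] n M2[OF n] by (simp add: field_simps)
    with * show "covering_radius (X (M n)) \<le> \<theta> / real n" by linarith
  qed
  have mesh: "sup_norm S2 p * \<kappa> \<le> sup_norm (X (M n)) p" if n: "n \<ge> 1" and p: "p \<in> sph_poly n" for n p
  proof -
    have "\<theta> / real n \<le> 1" "real n * (\<theta> / real n) = \<theta>" using n \<theta> by (simp_all add: field_simps)
    then show ?thesis
      using sphere_covering_mesh[OF n X(1-3,5)[OF n] _ p] by (simp only: \<kappa>_def)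
  qed
  have C0: "C n \<ge> 0" if "n \<ge> 1" for n
  proof -
    have "0 \<le> \<kappa> * C n" unfolding \<kappa>_def
      by (rule order_trans[OF real_sqrt_ge_zero[OF of_nat_0_le_iff] C[OF that]])
    then show ?thesis using \<kappa> by (simp add: zero_le_mult_iff)
  qed
  have sqrtM: "sqrt (card (X (M n))) \<le> \<kappa> * C n" if "n \<ge> 1" for n
    using C[OF that] X(4)[OF that] by (simp add: \<kappa>_def)
  have dim_O: "real (card (A n)) \<le> L * real (sph_dim n)"
    if "real (card (A n)) \<le> L * (real n + 1)\<^sup>2" for A :: "nat \<Rightarrow> (real^3) set" and L n
    using that by (simp add: sph_dim_eq add.commute)
  show "optimal_mesh (\<lambda>n. X (M n)) D"
    unfolding optimal_mesh_def
  proof (intro conjI allI impI ballI X)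
    fix n p assume n: "(n::nat) \<ge> 1" and p: "p \<in> sph_poly n"
    have "0 \<le> sup_norm S2 p"
      by (rule sup_norm_attained_S2[OF continuous_on_sph_poly[OF p]]) simp
    then have "\<kappa> * sup_norm S2 p \<le> \<kappa> * (D * (\<kappa> * sup_norm S2 p))"
      using D \<kappa> mult_right_mono[of 1 "\<kappa> * D" "\<kappa> * sup_norm S2 p"] by (simp add: \<kappa>_def mult_ac)
    then have "sup_norm S2 p \<le> D * (\<kappa> * sup_norm S2 p)" using \<kappa> by simp
    moreover have "0 < \<kappa> * D" using D unfolding \<kappa>_def by linarith
    then have "D > 0" using \<kappa>(1) by (rule zero_less_mult_pos)
    then have "D * (\<kappa> * sup_norm S2 p) \<le> D * sup_norm (X (M n)) p"
      using mesh[OF n p] by (intro mult_left_mono) (simp_all add: mult_ac)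
    ultimately show "sup_norm S2 p \<le> D * sup_norm (X (M n)) p" by simp
  next
    have "real (card (X (M n))) \<le> K\<^sup>2 * real (sph_dim n)" if n: "n \<ge> 1" for n
    proof (rule dim_O)
      have "sqrt (card (X (M n))) \<le> C n"
        using sqrtM[OF n] mult_right_mono[OF \<kappa>(2) C0[OF n]] by simp
      also have "\<dots> \<le> K * real n" by (rule K[OF n])
      finally have "(sqrt (card (X (M n))))\<^sup>2 \<le> (K * real n)\<^sup>2" by (intro power_mono) auto
      also have "\<dots> \<le> K\<^sup>2 * (real n + 1)\<^sup>2"
        unfolding power_mult_distrib by (intro mult_left_mono power_mono) auto
      finally show "real (card (X (M n))) \<le> K\<^sup>2 * (real n + 1)\<^sup>2" by simp
    qed
    then show "(\<lambda>n. real (card (X (M n)))) \<in> O(\<lambda>n. real (sph_dim n))"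
      by (intro bigoI[of _ "K\<^sup>2"] eventually_sequentiallyI[of 1]) simp
  qed
  show "weakly_admissible_mesh T C"
    unfolding weakly_admissible_mesh_def
  proof (intro conjI allI impI ballI)
    fix n :: nat assume n: "n \<ge> 1"
    show "finite (T n)" "T n \<noteq> {}" "T n \<subseteq> S2"
      by (rule ct_submesh_nodes[OF ct[OF n] X(1-3)[OF n]])+
    show "sup_norm S2 p \<le> C n * sup_norm (T n) p" if "p \<in> sph_poly n" for p
      by (rule ct_submesh_mesh[OF ct[OF n] X(1-3)[OF n] mesh[OF n] \<kappa>(1) sqrtM[OF n] that])
  next
    \<comment> \<open>The factor 4 comes from (2n + 1)^2 \<le> (2(n + 1))^2 and
      \<open>sph_dim_eq\<close>.\<close>
    have "real (card (T n)) \<le> 4 * real (sph_dim n)" if n: "n \<ge> 1" for n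
    proof (rule dim_O)
      have "real (card (T n)) \<le> real (sph_dim (2 * n))" using ct[OF n] by (simp add: ct_submesh_def)
      also have "\<dots> \<le> (2 * (real n + 1))\<^sup>2" unfolding sph_dim_eq of_nat_power
        by (intro power_mono) auto
      finally show "real (card (T n)) \<le> 4 * (real n + 1)\<^sup>2" by (simp only: power_mult_distrib) simp
    qed
    then have "(\<lambda>n. real (card (T n))) \<in> O(\<lambda>n. real (sph_dim n) powr 1)"
      by (intro bigoI[of _ 4] eventually_sequentiallyI[of 1]) simp
    then show "\<exists>\<beta>\<ge>1. (\<lambda>n. real (card (T n))) \<in> O(\<lambda>n. real (sph_dim n) powr \<beta>)"
      by (intro exI[of _ 1]) simp
  next
    fix r :: real assume r: "r > 1"
    have "C \<in> O(\<lambda>n. real n)"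
      using K C0 by (intro bigoI[of _ K] eventually_sequentiallyI[of 1]) simp
    also have "(\<lambda>n. real n) \<in> O(\<lambda>n. r ^ n)" using r by real_asymp
    finally show "C \<in> O(\<lambda>n. r ^ n)" .
  qed
  show "\<forall>n\<ge>1. \<forall>f. continuous_on S2 f \<longrightarrow>
     (\<exists>!p. is_wls n (T n) (w n) f p) \<and>
     (\<exists>q. is_best_approx n f q \<and>
        sup_norm S2 (\<lambda>x. f x - wls n (T n) (w n) f x) \<le> (1 + C n) * sup_norm S2 (\<lambda>x. f x - q x))"
  proof (intro allI impI conjI)
    fix n :: nat and f :: "real^3 \<Rightarrow> real" assume n: "n \<ge> 1" and f: "continuous_on S2 f"
    note facts = ct[OF n] X(1-3)[OF n] mesh[OF n] \<kappa>(1) sqrtM[OF n]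
    show "\<exists>!p. is_wls n (T n) (w n) f p" by (rule ct_submesh_is_wls_unique[OF facts])
    obtain q where q: "is_best_approx n f q" using is_best_approx_exists[OF f] by blast
    then have "q \<in> sph_poly n" by (simp add: is_best_approx_def is_arg_min_def)
    with q show "\<exists>q. is_best_approx n f q \<and>
        sup_norm S2 (\<lambda>x. f x - wls n (T n) (w n) f x) \<le> (1 + C n) * sup_norm S2 (\<lambda>x. f x - q x)"
      using ct_submesh_wls_error[OF facts f] by blast
  qed
qed

section \<open>Cardinalities and constants\<close>

text \<open>Dividing numerator and denominator by 2 pi gives \<sigma>_n = \<alpha>/(\<theta> d) with
  d = 1 - \<theta>/(2 pi n). The bound 5/6 for d follows from pi > 3 and \<theta> < 1 \<le>
  n.\<close>

lemma mesh_sigma_eq: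
  assumes "n \<ge> 1" "0 < \<theta>" "\<theta> < 1"
  shows "mesh_sigma \<alpha> \<theta> n * real n * (\<theta> * (1 - \<theta> / (2 * pi * real n))) = \<alpha> * real n"
    and "0 < 1 - \<theta> / (2 * pi * real n)" "1 - \<theta> / (2 * pi * real n) \<le> 1" "5 / 6 \<le>
      1 - \<theta> / (2 * pi * real n)"
proof -
  have "3 * \<theta> \<le> pi * real n" using assms pi_gt3 by (intro mult_mono) auto
  then have "6 * \<theta> \<le> 2 * pi * real n" by simp
  moreover have "0 < 2 * pi * real n" using assms by simp
  ultimately show *: "5 / 6 \<le> 1 - \<theta> / (2 * pi * real n)"  by (simp add: field_simps)
  then show "0 < 1 - \<theta> / (2 * pi * real n)" by simp
  show "1 - \<theta> / (2 * pi * real n) \<le> 1" using assms by simp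
  have "2 * pi - \<theta> / real n = 2 * pi * (1 - \<theta> / (2 * pi * real n))" by (simp add: algebra_simps)
  then have "mesh_sigma \<alpha> \<theta> n = \<alpha> / (\<theta> * (1 - \<theta> / (2 * pi * real n)))"
    unfolding mesh_sigma_def by simp
  then show "mesh_sigma \<alpha> \<theta> n * real n * (\<theta> * (1 - \<theta> / (2 * pi * real n))) = \<alpha> * real n"
    using * assms by simp
qed

lemma mesh_const_zonal:
  "n \<ge> 1 \<Longrightarrow> mesh_const (7 / 2) (1 / 2) n = zonal_mesh_const n"
proof -
  assume n: "n \<ge> 1"
  have "12 * 1 \<le> 4 * pi * real n" using n pi_gt3 by (intro mult_mono) auto
  then show ?thesis using n unfolding mesh_const_def mesh_sigma_def zonal_mesh_const_def
    by (simp add: field_simps)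
qed

lemma nat_ceiling_bounds:
  assumes "0 \<le> x"
  shows "x \<le> real (nat \<lceil>x\<rceil>)" "real (nat \<lceil>x\<rceil>) \<le> x + 1"
  using assms by (simp_all add: of_nat_nat)

text \<open>The cardinality is rounded up, so its square root may exceed $\sigma_n n$; since
  $\alpha \geq 2$, the relative excess is at most $\theta^2/8$, less than what the quadratic mesh
  constant $1/(1 - 18\theta^2/25)$ gains over $1/(1-\theta)$.\<close>

lemma mesh_card_bounds:
  assumes \<alpha>: "\<alpha> \<ge> 2" and \<theta>: "0 < \<theta>" "\<theta> < 1" and n: "n \<ge> 1"
  shows "mesh_card \<alpha> \<theta> n \<ge> 2"
    and "\<alpha> * real n \<le> \<theta> * sqrt (mesh_card \<alpha> \<theta> n)"
    and "sqrt (mesh_card \<alpha> \<theta> n) \<le> (1 - 18 / 25 * \<theta>\<^sup>2) * mesh_const \<alpha> \<theta> n"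
    and "mesh_const \<alpha> \<theta> n \<le> 6 / 5 * \<alpha> / (\<theta> * (1 - \<theta>)) * real n"
proof -
  define m where "m = mesh_sigma \<alpha> \<theta> n * real n"
  define d where "d = 1 - \<theta> / (2 * pi * real n)"
  have d: "0 < d" "d \<le> 1" "5 / 6 \<le> d" and md: "m * (\<theta> * d) = \<alpha> * real n"
    using mesh_sigma_eq[OF n \<theta>] by (auto simp: m_def d_def)
  have m0: "m > 0" using md \<alpha> n \<theta> d
    by (metis mult_pos_pos zero_less_mult_pos2 of_nat_0_less_iff less_le_trans zero_less_numeral
      zero_less_one)
  have "m * \<theta> * d \<le> m * \<theta> * 1" using m0 \<theta> by (intro mult_left_mono d) auto
  then have m1: "\<alpha> * real n \<le> \<theta> * m" using md by (simp add: mult_ac)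
  have "2 * 1 \<le> \<alpha> * real n" using \<alpha> n by (intro mult_mono) auto
  with m1 have m2: "2 \<le> \<theta> * m" by simp
  also have "\<dots> \<le> m" using \<theta> m0 by simp
  finally have "2\<^sup>2 \<le> m\<^sup>2" by (intro power_mono) auto
  have Mdef: "mesh_card \<alpha> \<theta> n = nat \<lceil>m\<^sup>2\<rceil>" by (simp add: mesh_card_def m_def power_mult_distrib)
  have M: "m\<^sup>2 \<le> real (mesh_card \<alpha> \<theta> n)" "real (mesh_card \<alpha> \<theta> n) \<le> m\<^sup>2 + 1"
    unfolding Mdef by (rule nat_ceiling_bounds; simp)+
  show "mesh_card \<alpha> \<theta> n \<ge> 2" using M(1) \<open>2\<^sup>2 \<le> m\<^sup>2\<close> by simp
  have "m \<le> sqrt (mesh_card \<alpha> \<theta> n)" using M(1) by (rule real_le_rsqrt)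
  then have "\<theta> * m \<le> \<theta> * sqrt (mesh_card \<alpha> \<theta> n)" using \<theta> by simp
  with m1 show "\<alpha> * real n \<le> \<theta> * sqrt (mesh_card \<alpha> \<theta> n)" by simp
  \<comment> \<open>As \<theta>m \<ge> \<alpha>n \<ge> 2, the rounding error 1 is at most
    (\<theta>m)^2/4, which is the cross term in the square of m(1 + \<theta>^2/8).\<close>
  have "2\<^sup>2 \<le> (\<theta> * m)\<^sup>2" using m2 by (intro power_mono) auto
  then have "m\<^sup>2 + 1 \<le> m\<^sup>2 + (\<theta> * m)\<^sup>2 / 4" by simp
  also have "\<dots> \<le> m\<^sup>2 + (\<theta> * m)\<^sup>2 / 4 + (m * \<theta>\<^sup>2 / 8)\<^sup>2" by simp
  also have "\<dots> = (m * (1 + \<theta>\<^sup>2 / 8))\<^sup>2"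
    by (simp add: power2_eq_square algebra_simps)
  finally have "real (mesh_card \<alpha> \<theta> n) \<le> (m * (1 + \<theta>\<^sup>2 / 8))\<^sup>2" using M(2) by simp
  then have "sqrt (mesh_card \<alpha> \<theta> n) \<le> m * (1 + \<theta>\<^sup>2 / 8)"
    using m0 by (intro real_le_lsqrt) (auto intro!: mult_nonneg_nonneg add_nonneg_nonneg)
  also have "\<dots> \<le> m * ((1 - 18 / 25 * \<theta>\<^sup>2) / (1 - \<theta>))"
  proof (rule mult_left_mono)
    \<comment> \<open>From \<theta>^2 \<le> \<theta> one gets -\<theta> + \<theta>^2/8 \<le> -(7/8)
      \<theta>^2, and 7/8 exceeds 18/25.\<close>
    have "\<theta> * \<theta> \<le> 1 * \<theta>" "0 \<le> \<theta> * (\<theta> * \<theta>)" using \<theta> by (auto intro: mult_right_mono)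
    moreover have "(1 + \<theta>\<^sup>2 / 8) * (1 - \<theta>) = 1 - \<theta> + \<theta> * \<theta> / 8 - \<theta> * (\<theta> * \<theta>) / 8"
      by (simp add: power2_eq_square field_simps)
    ultimately have "(1 + \<theta>\<^sup>2 / 8) * (1 - \<theta>) \<le> 1 - 18 / 25 * \<theta>\<^sup>2"
      using \<theta> unfolding power2_eq_square by linarith
    then show "1 + \<theta>\<^sup>2 / 8 \<le> (1 - 18 / 25 * \<theta>\<^sup>2) / (1 - \<theta>)" using \<theta> by (simp add: pos_le_divide_eq)
  qed (use m0 in simp)
  finally show "sqrt (mesh_card \<alpha> \<theta> n) \<le> (1 - 18 / 25 * \<theta>\<^sup>2) * mesh_const \<alpha> \<theta> n"
    by (simp add: mesh_const_def m_def mult_ac)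
  have "m * \<theta> * (5 / 6) \<le> m * \<theta> * d" using d m0 \<theta> by (intro mult_left_mono) auto
  then have "m * \<theta> \<le> 6 / 5 * \<alpha> * real n" using md by (simp add: mult_ac)
  then have "m \<le> 6 / 5 * \<alpha> * real n / \<theta>" using \<theta> by (simp add: pos_le_divide_eq)
  then have "m / (1 - \<theta>) \<le> 6 / 5 * \<alpha> * real n / \<theta> / (1 - \<theta>)"
    using \<theta> by (intro divide_right_mono) auto
  then show "mesh_const \<alpha> \<theta> n \<le> 6 / 5 * \<alpha> / (\<theta> * (1 - \<theta>)) * real n"
    by (simp add: mesh_const_def m_def)
qed

text \<open>As $n - 1/(4\pi) < \sigma_n n / 7$, the covering only guarantees the radius $6/(11 n)$ instead
  of $1/(2n)$.\<close>

lemma zonal_mesh_card_bounds: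
  assumes n: "n \<ge> 1"
  shows "zonal_mesh_card n \<ge> 2"
    and "7 / 2 * real n \<le> 6 / 11 * sqrt (zonal_mesh_card n)"
    and "sqrt (zonal_mesh_card n) \<le> (1 - 18 / 25 * (6 / 11)\<^sup>2) * zonal_mesh_const n"
    and "zonal_mesh_const n \<le> 16 * real n"
proof -
  define v where "v = real n - 1 / (4 * pi)"
  have "1 / (4 * pi) \<le> 1 / 12" using pi_gt3 by (simp add: field_simps)
  \<comment> \<open>The factor 11/12 is the source of 6/11 = (7/2) / (7 * 11/12).\<close>
  then have v1: "11 / 12 * real n \<le> v" using n unfolding v_def by linarith
  have "1 / 16 \<le> 1 / (4 * pi)" using pi_less_4 by (simp add: field_simps)
  then have v2: "v \<le> real n - 1 / 16" by (simp add: v_def)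
  have v3: "11 / 12 \<le> v" using v1 n by simp
  have M: "49 * v\<^sup>2 \<le> real (zonal_mesh_card n)" "real (zonal_mesh_card n) \<le> 49 * v\<^sup>2 + 1"
    unfolding zonal_mesh_card_def v_def[symmetric] by (rule nat_ceiling_bounds; simp)+
  have "(11 / 12)\<^sup>2 \<le> v\<^sup>2" using v3 by (intro power_mono) auto
  then show "zonal_mesh_card n \<ge> 2" using M(1) by (simp add: power2_eq_square)
  have "7 * v \<le> sqrt (zonal_mesh_card n)" using M(1)
    by (intro real_le_rsqrt) (simp add: power_mult_distrib)
  then show "7 / 2 * real n \<le> 6 / 11 * sqrt (zonal_mesh_card n)" using v1 by simp
  have "v\<^sup>2 \<le> (real n - 1 / 16)\<^sup>2" using v2 v3 by (intro power_mono) auto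
  \<comment> \<open>Replacing n by n - 1/16 lowers 49 n^2 by more than 1, which absorbs the
    rounding.\<close>
  then have "49 * v\<^sup>2 + 1 \<le> (7 * real n)\<^sup>2" using n by (simp add: power2_eq_square algebra_simps)
  with M(2) have M7: "sqrt (zonal_mesh_card n) \<le> 7 * real n" by (intro real_le_lsqrt) auto
  define d where "d = 1 - 1 / (4 * pi * real n)"
  have "12 * 1 \<le> 4 * pi * real n" using n pi_gt3 by (intro mult_mono) auto
  then have d: "11 / 12 \<le> d" "d \<le> 1" by (auto simp: d_def field_simps)
  have C: "zonal_mesh_const n = 14 * real n / d" by (simp add: zonal_mesh_const_def d_def)
  have "14 * real n * d \<le> 14 * real n * 1" by (intro mult_left_mono d) auto
  then have "14 * real n \<le> zonal_mesh_const n" using d by (simp add: C pos_le_divide_eq)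
  \<comment> \<open>\<kappa> = 1 - 648/3025 exceeds 1/2, so half of the constant, at least 7n,
    already dominates the square root of the cardinality.\<close>
  then have "1 / 2 * (14 * real n) \<le> (1 - 18 / 25 * (6 / 11)\<^sup>2) * zonal_mesh_const n"
    by (intro mult_mono) (auto simp: power2_eq_square)
  with M7 show "sqrt (zonal_mesh_card n) \<le> (1 - 18 / 25 * (6 / 11)\<^sup>2) * zonal_mesh_const n" by simp
  have "16 * real n * (11 / 12) \<le> 16 * real n * d" using d by (intro mult_left_mono) auto
  then show "zonal_mesh_const n \<le> 16 * real n" unfolding C using d by (simp add: divide_le_eq)
qed

lemma mesh_asymptotics:
  assumes "0 < \<alpha>" "0 < \<theta>" "\<theta> < 1"
  shows "mesh_sigma \<alpha> \<theta> \<sim>[at_top] (\<lambda>n. \<alpha> / \<theta>)"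
    and "mesh_const \<alpha> \<theta> \<sim>[at_top] (\<lambda>n. \<alpha> * real n / (\<theta> * (1 - \<theta>)))"
proof -
  have "(\<lambda>n. 2 * pi * \<alpha> / (\<theta> * (2 * pi - \<theta> / real n))) \<longlonglongrightarrow> 2 * pi * \<alpha> / (\<theta> * (2 * pi - 0))"
    using assms by (intro tendsto_intros lim_const_over_n) auto
  then show sigma: "mesh_sigma \<alpha> \<theta> \<sim>[at_top] (\<lambda>n. \<alpha> / \<theta>)"
    using assms by (intro tendsto_imp_asymp_equiv_const) (auto simp: mesh_sigma_def[abs_def])
  have "(\<lambda>n. mesh_sigma \<alpha> \<theta> n * real n / (1 - \<theta>)) \<sim>[at_top] (\<lambda>n. \<alpha> / \<theta> * real n / (1 - \<theta>))"
    by (intro asymp_equiv_intros sigma)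
  then show "mesh_const \<alpha> \<theta> \<sim>[at_top] (\<lambda>n. \<alpha> * real n / (\<theta> * (1 - \<theta>)))"
    by (simp add: mesh_const_def[abs_def])
qed

lemma zonal_mesh_const_asymptotics: "zonal_mesh_const \<sim>[at_top] (\<lambda>n. 14 * real n)"
proof -
  have "\<forall>\<^sub>F n in at_top. mesh_const (7 / 2) (1 / 2) n = zonal_mesh_const n"
    by (intro eventually_sequentiallyI[of 1] mesh_const_zonal)
  then have "zonal_mesh_const \<sim>[at_top] mesh_const (7 / 2) (1 / 2)"
    by (intro asymp_equiv_refl_ev) (simp add: eq_commute)
  also have "mesh_const (7 / 2) (1 / 2) \<sim>[at_top] (\<lambda>n. 14 * real n)"
    using mesh_asymptotics(2)[of "7 / 2" "1 / 2"] by simp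
  finally show ?thesis .
qed

section \<open>The general and the zonal meshes\<close>

lemma good_covering_ct_mesh:
  fixes X T :: "nat \<Rightarrow> (real^3) set" and \<alpha> \<theta> :: real and w :: "nat \<Rightarrow> real^3 \<Rightarrow> real"
  assumes X: "good_covering X \<alpha>" and \<theta>: "0 < \<theta>" "\<theta> < 1"
    and ct: "\<forall>n\<ge>1. ct_submesh n (X (mesh_card \<alpha> \<theta> n)) (T n) (w n)"
  shows "optimal_mesh (\<lambda>n. X (mesh_card \<alpha> \<theta> n)) (1 / (1 - \<theta>))"
    and "weakly_admissible_mesh T (mesh_const \<alpha> \<theta>)"
    and "\<forall>n\<ge>1. \<forall>f. continuous_on S2 f \<longrightarrow>
           (\<exists>!p. is_wls n (T n) (w n) f p) \<and>
           (\<exists>q. is_best_approx n f q \<and>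
              sup_norm S2 (\<lambda>x. f x - wls n (T n) (w n) f x)
                \<le> (1 + mesh_const \<alpha> \<theta> n) * sup_norm S2 (\<lambda>x. f x - q x))"
proof -
  have \<alpha>: "\<alpha> \<ge> 2" using X by (rule good_covering_const_ge_2)
  \<comment> \<open>(18/25) \<theta>^2 \<le> \<theta>^2 \<le> \<theta> gives \<kappa> \<ge> 1 -
    \<theta>, so 1/(1 - \<theta>) is a mesh constant.\<close>
  have "\<theta> * \<theta> \<le> 1 * \<theta>" using \<theta> by (intro mult_right_mono) auto
  then have D: "1 \<le> (1 - 18 / 25 * \<theta>\<^sup>2) * (1 / (1 - \<theta>))"
    using \<theta> by (simp add: power2_eq_square)
  note mesh = covering_ct_mesh[where X = X and T = T and w = w and M = "mesh_card \<alpha> \<theta>"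
      and C = "mesh_const \<alpha> \<theta>", OF X ct[rule_format] \<theta>(1) less_imp_le[OF \<theta>(2)]
      mesh_card_bounds(1,2)[OF \<alpha> \<theta>] D mesh_card_bounds(3,4)[OF \<alpha> \<theta>]]
  show "optimal_mesh (\<lambda>n. X (mesh_card \<alpha> \<theta> n)) (1 / (1 - \<theta>))"
    "weakly_admissible_mesh T (mesh_const \<alpha> \<theta>)"
    "\<forall>n\<ge>1. \<forall>f. continuous_on S2 f \<longrightarrow>
       (\<exists>!p. is_wls n (T n) (w n) f p) \<and>
       (\<exists>q. is_best_approx n f q \<and>
          sup_norm S2 (\<lambda>x. f x - wls n (T n) (w n) f x)
            \<le> (1 + mesh_const \<alpha> \<theta> n) * sup_norm S2 (\<lambda>x. f x - q x))"
    by (rule mesh; assumption)+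
qed

text \<open>\<open>covering_ct_mesh\<close> is used with 6/11 in place of 1/2, the radius that the
  smaller cardinality guarantees; since \<kappa> still exceeds 1/2, the mesh constant 2
  survives.\<close>

lemma zonal_ct_mesh:
  fixes Z T :: "nat \<Rightarrow> (real^3) set" and w :: "nat \<Rightarrow> real^3 \<Rightarrow> real"
  assumes Z: "good_covering Z (7 / 2)"
    and ct: "\<forall>n\<ge>1. ct_submesh n (Z (zonal_mesh_card n)) (T n) (w n)"
  shows "optimal_mesh (\<lambda>n. Z (zonal_mesh_card n)) 2"
    and "weakly_admissible_mesh T zonal_mesh_const"
    and "\<forall>n\<ge>1. \<forall>f. continuous_on S2 f \<longrightarrow>
           (\<exists>!p. is_wls n (T n) (w n) f p) \<and>
           (\<exists>q. is_best_approx n f q \<and>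
              sup_norm S2 (\<lambda>x. f x - wls n (T n) (w n) f x)
                \<le> (1 + zonal_mesh_const n) * sup_norm S2 (\<lambda>x. f x - q x))"
proof -
  have \<theta>: "0 < (6 / 11 :: real)" "6 / 11 \<le> (1 :: real)" by simp_all
  have D: "1 \<le> (1 - 18 / 25 * (6 / 11)\<^sup>2) * (2 :: real)" by (simp add: power2_eq_square)
  note mesh = covering_ct_mesh[where X = Z and T = T and w = w and M = zonal_mesh_card
      and C = zonal_mesh_const, OF Z ct[rule_format] \<theta> zonal_mesh_card_bounds(1,2) D
      zonal_mesh_card_bounds(3,4)]
  show "optimal_mesh (\<lambda>n. Z (zonal_mesh_card n)) 2"
    "weakly_admissible_mesh T zonal_mesh_const"
    "\<forall>n\<ge>1. \<forall>f. continuous_on S2 f \<longrightarrow>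
       (\<exists>!p. is_wls n (T n) (w n) f p) \<and>
       (\<exists>q. is_best_approx n f q \<and>
          sup_norm S2 (\<lambda>x. f x - wls n (T n) (w n) f x)
            \<le> (1 + zonal_mesh_const n) * sup_norm S2 (\<lambda>x. f x - q x))"
    by (rule mesh; assumption)+
qed

theorem corollary2:
  shows "(\<forall>(X :: nat \<Rightarrow> (real^3) set) (\<alpha>::real) (\<theta>::real)
             (T :: nat \<Rightarrow> (real^3) set) (w :: nat \<Rightarrow> real^3 \<Rightarrow> real).
            good_covering X \<alpha> \<and> 0 < \<theta> \<and> \<theta> < 1 \<and>
            (\<forall>n\<ge>1. ct_submesh n (X (mesh_card \<alpha> \<theta> n)) (T n) (w n)) \<longrightarrow>
              optimal_mesh (\<lambda>n. X (mesh_card \<alpha> \<theta> n)) (1 / (1 - \<theta>)) \<and>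
              weakly_admissible_mesh T (mesh_const \<alpha> \<theta>) \<and>
              (\<forall>n\<ge>1. card (T n) \<le> sph_dim (2 * n) \<and> sph_dim (2 * n) = (2 * n + 1)\<^sup>2) \<and>
              (\<forall>n\<ge>1. \<forall>f. continuous_on S2 f \<longrightarrow>
                 (\<exists>!p. is_wls n (T n) (w n) f p) \<and>
                 (\<exists>q. is_best_approx n f q \<and>
                    sup_norm S2 (\<lambda>x. f x - wls n (T n) (w n) f x)
                      \<le> (1 + mesh_const \<alpha> \<theta> n) * sup_norm S2 (\<lambda>x. f x - q x))) \<and>
              mesh_sigma \<alpha> \<theta> \<sim>[at_top] (\<lambda>n. \<alpha> / \<theta>) \<and>
              mesh_const \<alpha> \<theta> \<sim>[at_top] (\<lambda>n. \<alpha> * real n / (\<theta> * (1 - \<theta>)))) \<and>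
         (\<forall>(Z :: nat \<Rightarrow> (real^3) set) (T :: nat \<Rightarrow> (real^3) set)
             (w :: nat \<Rightarrow> real^3 \<Rightarrow> real).
            (\<forall>M\<ge>2. zonal_equal_area M (Z M)) \<and> good_covering Z (7 / 2) \<and>
            (\<forall>n\<ge>1. ct_submesh n (Z (zonal_mesh_card n)) (T n) (w n)) \<longrightarrow>
              optimal_mesh (\<lambda>n. Z (zonal_mesh_card n)) 2 \<and>
              weakly_admissible_mesh T zonal_mesh_const \<and>
              (\<forall>n\<ge>1. card (T n) \<le> sph_dim (2 * n)) \<and>
              (\<forall>n\<ge>1. \<forall>f. continuous_on S2 f \<longrightarrow>
                 (\<exists>!p. is_wls n (T n) (w n) f p) \<and>
                 (\<exists>q. is_best_approx n f q \<and>
                    sup_norm S2 (\<lambda>x. f x - wls n (T n) (w n) f x)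
                      \<le> (1 + zonal_mesh_const n) * sup_norm S2 (\<lambda>x. f x - q x)))) \<and>
         (\<forall>n\<ge>1. mesh_const (7 / 2) (1 / 2) n = zonal_mesh_const n) \<and>
         zonal_mesh_const \<sim>[at_top] (\<lambda>n. 14 * real n)"
proof (intro conjI, goal_cases)
  case 1
  have card: "\<forall>n\<ge>1. card (T n) \<le> sph_dim (2 * n) \<and> sph_dim (2 * n) = (2 * n + 1)\<^sup>2"
    if "\<forall>n\<ge>1. ct_submesh n (A n) (T n) (w n)" for A T :: "nat \<Rightarrow> (real^3) set" and w
    using that by (simp add: ct_submesh_def sph_dim_eq)
  have "0 < \<alpha>" if "good_covering X \<alpha>" for X \<alpha>
    using that by (simp add: good_covering_def)
  then show ?case
    by (intro allI impI, elim conjE, intro conjI)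
       (rule good_covering_ct_mesh card mesh_asymptotics; assumption?; blast)+
next
  case 2
  have card: "\<forall>n\<ge>1. card (T n) \<le> sph_dim (2 * n)"
    if "\<forall>n\<ge>1. ct_submesh n (A n) (T n) (w n)" for A T :: "nat \<Rightarrow> (real^3) set" and w
    using that by (simp add: ct_submesh_def)
  show ?case
    by (intro allI impI, elim conjE, intro conjI) (rule zonal_ct_mesh card; assumption)+
next
  case 3
  show ?case using mesh_const_zonal by blast
next
  case 4
  show ?case by (rule zonal_mesh_const_asymptotics)
qed

end
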